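(* Let $I$ be a compact interval and let $f : I \to I$ be a $C^2$ map all of whose critical points are $C^2$ nonflat. Then there exists a gauge function $\sigma$ with the following property. If $J\subset T$ are open subintervals of $I$ and $n\in\mathbb{N}$ is such that $f^n$ is a diffeomorphism on $T$, then for every $x,y\in J$, $$\frac{(f^n)'(x)}{(f^n)'(y)}\ \geq\ \frac{\exp\left(-\sigma\left(\max_{0\le i\le n-1}|f^i(T)|\right)\sum_{i=0}^{n-1}|f^i(J)|\right)}{\left(1+\nu(f^n(J),f^n(T))\right)^2}.$$
   Context: A critical point of a $C^1$ map $f$ is a point $c$ with $f'(c)=0$. It is $C^n$ nonflat if there is $\ell>1$ such that, near $c$, $f(x)=\pm|\phi(x)|^\ell+f(c)$ where $\phi$ is a $C^n$ diffeomorphism. A gauge function is a continuous increasing function $\sigma:\mathbb{R}\to\mathbb{R}$ with $\sigma(0)=0$. $|A|$ denotes the length of an interval $A$. For open intervals $J\subset T$, $\nu(J,T):=\dfrac{|J|}{\operatorname{dist}(J,\partial T)}$; if $\operatorname{dist}(J,\partial T)=0$ this is read as $+\infty$ (and the lower bound in the claim is then $0$). *)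

theory Defs
  imports "HOL-Analysis.Analysis"
begin

text \<open>Differentiability is taken within the set, so at an endpoint of a compact interval the
  derivatives are one-sided.\<close>

fun C_on :: "nat \<Rightarrow> (real \<Rightarrow> real) \<Rightarrow> real set \<Rightarrow> bool" where
  "C_on 0 f S \<longleftrightarrow> continuous_on S f"
| "C_on (Suc k) f S \<longleftrightarrow>
     (\<exists>f'. (\<forall>x\<in>S. (f has_real_derivative f' x) (at x within S)) \<and> C_on k f' S)"

definition C_diffeo_on :: "nat \<Rightarrow> (real \<Rightarrow> real) \<Rightarrow> real set \<Rightarrow> bool" where
  "C_diffeo_on k f S \<longleftrightarrow>
     inj_on f S \<and> C_on k f S \<and> C_on k (inv_into S f) (f ` S)"

definition critical_point :: "(real \<Rightarrow> real) \<Rightarrow> real set \<Rightarrow> real \<Rightarrow> bool" where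
  "critical_point f S c \<longleftrightarrow> c \<in> S \<and> (f has_real_derivative 0) (at c within S)"

text \<open>The sign is chosen pointwise, so that inflection points such as \<open>0\<close> for \<open>x ^ 3\<close> are
  included along with turning points. If \<open>c\<close> is an endpoint of \<open>S\<close>, the normal form is only
  required on the side of \<open>c\<close> lying in \<open>S\<close>. The normal form at \<open>x = c\<close> forces \<open>\<phi> c = 0\<close>.\<close>

definition nonflat :: "nat \<Rightarrow> (real \<Rightarrow> real) \<Rightarrow> real set \<Rightarrow> real \<Rightarrow> bool" where
  "nonflat k f S c \<longleftrightarrow>
     (\<exists>l > 1. \<exists>U \<phi>. open U \<and> c \<in> U \<and> C_diffeo_on k \<phi> U \<and>
        (\<forall>x \<in> U \<inter> S. f x = \<bar>\<phi> x\<bar> powr l + f c \<or> f x = - (\<bar>\<phi> x\<bar> powr l) + f c))"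

definition gauge_function :: "(real \<Rightarrow> real) \<Rightarrow> bool" where
  "gauge_function \<sigma> \<longleftrightarrow> continuous_on UNIV \<sigma> \<and> strict_mono \<sigma> \<and> \<sigma> 0 = 0"

abbreviation len :: "real set \<Rightarrow> real" where
  "len A \<equiv> measure lborel A"

definition nu :: "real set \<Rightarrow> real set \<Rightarrow> ereal" where
  "nu J T =
     (if setdist J (frontier T) = 0 then \<infinity> else ereal (len J / setdist J (frontier T)))"

end

theory Submission
  imports Defs
begin

text \<open>
  For \<open>r\<close> strictly between \<open>q\<close> and \<open>s\<close> consider the degenerate cross ratio distortion
  \<open>F' r / F' q * ((F s - F q) / (F s - F r))\<^sup>2 * ((s - r) / (s - q))\<^sup>2\<close>, which is
  multiplicative under composition. If a single step satisfies the lower bound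
  \<open>exp (- \<sigma> \<bar>s - q\<bar> * \<bar>r - q\<bar>)\<close>, these bounds multiply along the orbit of \<open>T\<close>. Taking
  \<open>r = x\<close> and \<open>q = y\<close>, discarding the domain factor, which is at most \<open>1\<close>, and letting \<open>s\<close>
  tend to the end of \<open>T\<close> beyond \<open>x\<close> leaves exactly the Koebe factor.

  For the single step, the logarithmic derivative in \<open>r\<close> has to be at least
  \<open>- \<sigma> \<bar>s - r\<bar>\<close> (up to orientation). Where \<open>f'\<close> is bounded away from \<open>0\<close>, this is
  Taylor's formula and uniform continuity of \<open>f''\<close>. Near a critical point \<open>f\<close> is a diffeomorphism
  followed by a power map, and the power map only helps, because it has negative Schwarzian
  derivative. By compactness the error is at most \<open>\<eta> + K * \<bar>s - r\<bar>\<close> for every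
  \<open>\<eta> > 0\<close> and a suitable \<open>K\<close>, and the infimum of these affine bounds gives the gauge.
\<close>

section \<open>The Koebe defect\<close>

text \<open>Up to the factor \<open>s - t\<close>, the logarithmic derivative at \<open>r = t\<close> of the distortion
  \<open>koebe_ratio f f' q r s\<close> below.\<close>

definition koebe_defect ::
  "(real \<Rightarrow> real) \<Rightarrow> (real \<Rightarrow> real) \<Rightarrow> (real \<Rightarrow> real) \<Rightarrow> real \<Rightarrow> real \<Rightarrow> real" where
  "koebe_defect f f' f'' t s =
     (s - t) * f'' t / f' t + 2 * (s - t) * f' t / (f s - f t) - 2"

lemma mvt_segment:
  fixes g :: "real \<Rightarrow> real"
  assumes "t \<noteq> s"
    and dg: "\<And>x. x \<in> closed_segment t s \<Longrightarrow> (g has_real_derivative g' x) (at x)"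
  obtains z where "z \<in> open_segment t s" "g s - g t = (s - t) * g' z"
proof (cases "t < s")
  case True
  then obtain z where "z > t" "z < s" "g s - g t = (s - t) * g' z"
    using MVT2[of t s g g'] dg by (auto simp: closed_segment_eq_real_ivl)
  with True show ?thesis using that[of z] by (auto simp: open_segment_eq_real_ivl)
next
  case False
  with \<open>t \<noteq> s\<close> have "s < t" by simp
  then obtain z where "z > s" "z < t" "g t - g s = (t - s) * g' z"
    using MVT2[of s t g g'] dg by (auto simp: closed_segment_eq_real_ivl)
  with \<open>s < t\<close> show ?thesis using that[of z]
    by (auto simp: open_segment_eq_real_ivl algebra_simps)
qed

lemma connected_nonzero_same_sign:
  fixes g :: "real \<Rightarrow> real"
  assumes "connected W" "continuous_on W g" "\<And>x. x \<in> W \<Longrightarrow> g x \<noteq> 0" "x \<in> W" "y \<in> W"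
  shows "g x * g y > 0"
proof (rule ccontr)
  assume "\<not> g x * g y > 0"
  then have "(g x \<le> 0 \<and> 0 \<le> g y) \<or> (g y \<le> 0 \<and> 0 \<le> g x)"
    by (auto simp: not_less mult_le_0_iff)
  moreover have "connected (g ` W)"
    using assms(1,2) by (intro connected_continuous_image) auto
  ultimately have "0 \<in> g ` W"
    using assms(4,5) unfolding connected_iff_interval by blast
  with assms(3) show False by auto
qed

text \<open>By the mean value theorem the quotient equals \<open>f' t / f' z\<close> for an
  intermediate \<open>z\<close>, and \<open>f'\<close> keeps its sign on the segment.\<close>

lemma difference_quotient_pos:
  fixes f :: "real \<Rightarrow> real"
  assumes "t \<noteq> s"
    and df: "\<And>x. x \<in> closed_segment t s \<Longrightarrow> (f has_real_derivative f' x) (at x)"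
    and cont: "continuous_on (closed_segment t s) f'"
    and nz: "\<And>x. x \<in> closed_segment t s \<Longrightarrow> f' x \<noteq> 0"
  shows "(s - t) * f' t / (f s - f t) > 0"
proof -
  obtain z where z: "z \<in> open_segment t s" "f s - f t = (s - t) * f' z"
    using mvt_segment[of t s f f'] assms by blast
  have "f' t * f' z > 0"
    using z(1) by (intro connected_nonzero_same_sign[OF _ cont nz]) (auto simp: open_segment_def)
  then have "f' t / f' z > 0"
    by (auto simp: zero_less_divide_iff zero_less_mult_iff)
  with z(2) \<open>t \<noteq> s\<close> show ?thesis by simp
qed

text \<open>Second-order Taylor expansion at \<open>t\<close> writes \<open>f s - f t\<close> as
  \<open>(s - t) * f' t * (1 + u)\<close>. Since \<open>1 / (1 + u)\<close> is at least
  \<open>1 - u\<close>, the term \<open>2 * u\<close> cancels against the \<open>f'' t\<close> term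
  up to the oscillation of \<open>f''\<close>. No third derivative enters.\<close>

lemma koebe_defect_lower_bound:
  fixes f :: "real \<Rightarrow> real"
  assumes "t \<noteq> s"
    and df: "\<And>x. x \<in> closed_segment t s \<Longrightarrow> (f has_real_derivative f' x) (at x)"
    and df': "\<And>x. x \<in> closed_segment t s \<Longrightarrow> (f' has_real_derivative f'' x) (at x)"
    and nz: "\<And>x. x \<in> closed_segment t s \<Longrightarrow> f' x \<noteq> 0"
  obtains \<xi> where "\<xi> \<in> closed_segment t s"
    "koebe_defect f f' f'' t s \<ge> - (\<bar>s - t\<bar> * (\<bar>f'' \<xi> - f'' t\<bar> / \<bar>f' t\<bar>))"
proof -
  have cont: "continuous_on (closed_segment t s) f'"
    using df' by (meson DERIV_continuous continuous_at_imp_continuous_on)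
  define diff where "diff = (\<lambda>m::nat. if m = 0 then f else if m = 1 then f' else f'')"
  have seg: "x \<in> closed_segment t s \<longleftrightarrow> min t s \<le> x \<and> x \<le> max t s" for x
    by (auto simp: closed_segment_eq_real_ivl)
  have "\<exists>\<xi>. (if s < t then s < \<xi> \<and> \<xi> < t else t < \<xi> \<and> \<xi> < s) \<and>
      f s = (\<Sum>m<2. diff m t / fact m * (s - t) ^ m) + diff 2 \<xi> / fact 2 * (s - t) ^ 2"
    using \<open>t \<noteq> s\<close> df df'
    by (intro Taylor[where a = "min t s" and b = "max t s"])
      (auto simp: diff_def less_2_cases_iff seg)
  then obtain \<xi> where \<xi>: "if s < t then s < \<xi> \<and> \<xi> < t else t < \<xi> \<and> \<xi> < s"
    and eq: "f s = (\<Sum>m<2. diff m t / fact m * (s - t) ^ m) + diff 2 \<xi> / fact 2 * (s - t) ^ 2"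
    by blast
  have eq': "f s - f t = f' t * (s - t) + f'' \<xi> / 2 * (s - t)\<^sup>2"
    using eq by (simp add: diff_def numeral_2_eq_2)
  have mem: "\<xi> \<in> closed_segment t s"
    using \<xi> by (auto simp: closed_segment_eq_real_ivl split: if_splits)
  define u where "u = f'' \<xi> * (s - t) / (2 * f' t)"
  have ft: "f' t \<noteq> 0" using nz by simp
  have quot: "f s - f t = (s - t) * f' t * (1 + u)"
  proof -
    have "(s - t) * f' t * (1 + u) = (s - t) * f' t + (s - t) * (f' t * u)"
      by (simp add: algebra_simps)
    also have "f' t * u = f'' \<xi> * (s - t) / 2" using ft by (simp add: u_def)
    finally show ?thesis using eq' by (simp add: power2_eq_square mult_ac)
  qed
  have "(s - t) * f' t / (f s - f t) > 0"
    using difference_quotient_pos[OF \<open>t \<noteq> s\<close> df cont nz] .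
  then have pos: "1 + u > 0" and inv: "(s - t) * f' t / (f s - f t) = 1 / (1 + u)"
    using \<open>t \<noteq> s\<close> ft by (simp_all add: quot zero_less_divide_iff zero_less_mult_iff)
  have "1 / (1 + u) \<ge> 1 - u"
    using pos by (simp add: field_simps)
  then have "koebe_defect f f' f'' t s \<ge> (s - t) * f'' t / f' t + 2 * (1 - u) - 2"
  proof -
    have "2 * (s - t) * f' t / (f s - f t) = 2 * (1 / (1 + u))"
      using inv by (metis mult.assoc times_divide_eq_right)
    with \<open>1 / (1 + u) \<ge> 1 - u\<close> show ?thesis unfolding koebe_defect_def by simp
  qed
  also have "(s - t) * f'' t / f' t + 2 * (1 - u) - 2 = - ((s - t) * (f'' \<xi> - f'' t) / f' t)"
    using ft by (simp add: u_def field_simps)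
  finally have "koebe_defect f f' f'' t s \<ge> - \<bar>(s - t) * (f'' \<xi> - f'' t) / f' t\<bar>"
    by linarith
  then show ?thesis using that[OF mem] by (simp add: abs_mult)
qed

text \<open>With \<open>w = s / t\<close> this is the Koebe defect of \<open>x powr l\<close>. The second
  derivative of \<open>((l - 1) * (w - 1) - 2) * (w powr l - 1) + 2 * l * (w - 1)\<close> is
  \<open>l * (l - 1) * (l + 1) * (w - 1) * w powr (l - 2)\<close>, and the function vanishes to second
  order at \<open>1\<close>.\<close>

lemma power_defect_nonneg:
  fixes l w :: real
  assumes "l > 1" "w > 0" "w \<noteq> 1"
  shows "(l - 1) * (w - 1) + 2 * l * (w - 1) / (w powr l - 1) - 2 \<ge> 0"
proof -
  define k where "k = (\<lambda>w. ((l - 1) * (w - 1) - 2) * (w powr l - 1) + 2 * l * (w - 1))"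
  define k' where "k' = (\<lambda>w. (l - 1) * (w powr l - 1)
    + ((l - 1) * (w - 1) - 2) * (l * w powr (l - 1)) + 2 * l)"
  define k'' where "k'' = (\<lambda>w::real. l * (l - 1) * (l + 1) * (w - 1) * w powr (l - 2))"
  have dk: "(k has_real_derivative k' x) (at x)" if "x > 0" for x
    unfolding k_def k'_def using that
    by (auto intro!: derivative_eq_intros)
  have dk': "(k' has_real_derivative k'' x) (at x)" if "x > 0" for x
  proof -
    have e: "x powr (l - 1) = x powr (l - 2) * x"
      using that powr_add[of x "l - 2" 1] by simp
    show ?thesis
      unfolding k'_def k''_def using that
      by (auto intro!: derivative_eq_intros simp: e algebra_simps)
  qed
  have "k 1 = 0" "k' 1 = 0" by (simp_all add: k_def k'_def)
  have k'_nonneg: "k' x \<ge> 0" if "x > 0" for x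
  proof (cases "x \<ge> 1")
    case True
    have "k' 1 \<le> k' x"
    proof (rule DERIV_nonneg_imp_nondecreasing[of 1 x k'])
      fix y :: real assume "1 \<le> y"
      then show "\<exists>d. (k' has_real_derivative d) (at y) \<and> d \<ge> 0"
        using assms(1) by (intro exI[of _ "k'' y"] conjI dk') (auto simp: k''_def)
    qed (use True in simp)
    then show ?thesis using \<open>k' 1 = 0\<close> by simp
  next
    case False
    have "k' 1 \<le> k' x"
    proof (rule DERIV_nonpos_imp_nonincreasing[of x 1 k'])
      fix y :: real assume "x \<le> y" "y \<le> 1"
      then have "k'' y \<le> 0" using assms(1)
        unfolding k''_def by (intro mult_nonpos_nonneg[OF mult_nonneg_nonpos]) auto
      with \<open>x \<le> y\<close> show "\<exists>d. (k' has_real_derivative d) (at y) \<and> d \<le> 0"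
        using that by (intro exI[of _ "k'' y"] conjI dk') auto
    qed (use False in simp)
    then show ?thesis using \<open>k' 1 = 0\<close> by simp
  qed
  have mono: "k x \<le> k y" if "0 < x" "x \<le> y" for x y
  proof (rule DERIV_nonneg_imp_nondecreasing[of x y k])
    fix z assume "x \<le> z"
    then show "\<exists>d. (k has_real_derivative d) (at z) \<and> d \<ge> 0"
      using that by (intro exI[of _ "k' z"] conjI dk k'_nonneg) auto
  qed (use that in simp)
  \<comment> \<open>Over a common denominator the claim concerns the sign of \<open>k w\<close>: as
    \<open>k\<close> is nondecreasing with \<open>k 1 = 0\<close>, it never opposes the sign of
    \<open>w powr l - 1\<close>.\<close>
  have eq: "(l - 1) * (w - 1) + 2 * l * (w - 1) / (w powr l - 1) - 2 = k w / (w powr l - 1)"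
    if "w powr l \<noteq> 1"
    using that by (simp add: k_def field_simps)
  show ?thesis
  proof (cases "w > 1")
    case True
    then have "w powr l > 1" using assms(1) by (simp add: gr_one_powr)
    moreover have "k w \<ge> 0" using mono[of 1 w] True \<open>k 1 = 0\<close> by simp
    ultimately show ?thesis using eq by simp
  next
    case False
    then have "w powr l < 1"
      using assms powr_less_mono2[of l w 1] by simp
    moreover have "k w \<le> 0" using mono[of w 1] False assms \<open>k 1 = 0\<close> by simp
    ultimately show ?thesis using eq by (simp add: divide_nonpos_neg)
  qed
qed

section \<open>Compactness and gauge functions\<close>

text \<open>Below the radius \<open>\<rho>\<close> of uniform continuity the oscillation is under
  \<open>\<eta>\<close>; beyond it the crude bound \<open>2 * M\<close> is absorbed by the slope
  \<open>2 * M / \<rho>\<close>.\<close>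

lemma continuous_linear_modulus:
  fixes g :: "real \<Rightarrow> real"
  assumes "compact X" "continuous_on X g" "\<eta> > 0"
  obtains K where "K \<ge> 0" "\<And>x y. x \<in> X \<Longrightarrow> y \<in> X \<Longrightarrow> \<bar>g x - g y\<bar> \<le> \<eta> + K * \<bar>x - y\<bar>"
proof -
  obtain \<rho> where \<rho>: "\<rho> > 0" "\<And>x y. x \<in> X \<Longrightarrow> y \<in> X \<Longrightarrow> \<bar>x - y\<bar> < \<rho> \<Longrightarrow> \<bar>g x - g y\<bar> < \<eta>"
    using compact_uniformly_continuous[OF assms(2,1)] assms(3)
    unfolding uniformly_continuous_on_def dist_real_def by (metis abs_minus_commute)
  obtain M where M: "M > 0" "\<And>x. x \<in> X \<Longrightarrow> \<bar>g x\<bar> \<le> M"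
    using compact_imp_bounded[OF compact_continuous_image[OF assms(2,1)]]
    unfolding bounded_pos by auto
  show ?thesis
  proof (rule that[of "2 * M / \<rho>"])
    show "2 * M / \<rho> \<ge> 0" using M \<rho> by simp
    fix x y assume xy: "x \<in> X" "y \<in> X"
    show "\<bar>g x - g y\<bar> \<le> \<eta> + 2 * M / \<rho> * \<bar>x - y\<bar>"
    proof (cases "\<bar>x - y\<bar> < \<rho>")
      case True
      then have "\<bar>g x - g y\<bar> \<le> \<eta>" using \<rho> xy by fastforce
      moreover have "0 \<le> 2 * M / \<rho> * \<bar>x - y\<bar>" using M \<rho> by simp
      ultimately show ?thesis by linarith
    next
      case False
      have "\<bar>g x - g y\<bar> \<le> 2 * M" using M(2)[OF xy(1)] M(2)[OF xy(2)] by linarith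
      also have "\<dots> = 2 * M / \<rho> * \<rho>" using \<rho> by simp
      also have "\<dots> \<le> 2 * M / \<rho> * \<bar>x - y\<bar>" using False M \<rho> by (intro mult_left_mono) auto
      finally show ?thesis using assms(3) by linarith
    qed
  qed
qed

text \<open>A finite subcover leaves finitely many local constants, and monotonicity of
  \<open>P\<close> in its second argument lets their maximum serve everywhere.\<close>

lemma compact_uniform_bound:
  fixes K :: "'a::metric_space set" and P :: "'a \<Rightarrow> real \<Rightarrow> bool"
  assumes "compact K"
    and loc: "\<And>c. c \<in> K \<Longrightarrow> \<exists>r>0. \<exists>N. \<forall>t\<in>K. dist c t < r \<longrightarrow> P t N"
    and mono: "\<And>t N N'. P t N \<Longrightarrow> N \<le> N' \<Longrightarrow> P t N'"
  obtains N where "N \<ge> 0" "\<And>t. t \<in> K \<Longrightarrow> P t N"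
proof -
  obtain r N where rN: "\<And>c. c \<in> K \<Longrightarrow> r c > 0"
    "\<And>c t. c \<in> K \<Longrightarrow> t \<in> K \<Longrightarrow> dist c t < r c \<Longrightarrow> P t (N c)"
    using loc by metis
  obtain C where C: "C \<subseteq> K" "finite C" "K \<subseteq> (\<Union>c\<in>C. ball c (r c))"
    using compactE_image[OF \<open>compact K\<close>, of K "\<lambda>c. ball c (r c)"] rN(1) by force
  define M where "M = Max (insert 0 (N ` C))"
  show ?thesis
  proof (rule that[of M])
    show "M \<ge> 0" unfolding M_def using C(2) by simp
    fix t assume "t \<in> K"
    then obtain c where c: "c \<in> C" "dist c t < r c" using C(3) by auto
    then have "P t (N c)" using rN(2) C(1) \<open>t \<in> K\<close> by blast
    moreover have "N c \<le> M" unfolding M_def using c C(2) by (intro Max_ge) auto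
    ultimately show "P t M" by (rule mono)
  qed
qed

text \<open>The infimum \<open>h\<close> of the affine majorants of \<open>B\<close> with
  nonnegative coefficients is nondecreasing and concave, and concavity gives continuity on the
  positive axis. Continuity at 0 comes from the arbitrarily small intercepts
  \<open>\<eta>\<close>.\<close>

lemma gauge_majorant:
  fixes B :: "(real \<times> real) set"
  assumes B: "\<And>\<eta>. \<eta> > 0 \<Longrightarrow> \<exists>K\<ge>0. \<forall>(z, v)\<in>B. v \<le> \<eta> + K * z"
    and nonneg: "\<And>z v. (z, v) \<in> B \<Longrightarrow> z \<ge> 0"
  obtains \<sigma> where "gauge_function \<sigma>" "\<And>z v. (z, v) \<in> B \<Longrightarrow> v \<le> \<sigma> z"
proof -
  define L where "L = {(\<eta>, K). \<eta> \<ge> 0 \<and> K \<ge> 0 \<and> (\<forall>(z, v)\<in>B. v \<le> \<eta> + K * z)}"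
  define h where "h = (\<lambda>z. INF (\<eta>, K)\<in>L. \<eta> + K * z)"
  have ne: "L \<noteq> {}"
  proof -
    obtain K where "K \<ge> 0" "\<forall>(z, v)\<in>B. v \<le> 1 + K * z" using B[of 1] by auto
    then have "(1, K) \<in> L" by (simp add: L_def)
    then show ?thesis by blast
  qed
  have bdd: "bdd_below ((\<lambda>(\<eta>, K). \<eta> + K * z) ` L)" if "z \<ge> 0" for z
    using that by (auto simp: L_def intro!: bdd_belowI2[where m = 0])
  have h_le: "h z \<le> \<eta> + K * z" if "(\<eta>, K) \<in> L" "z \<ge> 0" for z \<eta> K
    unfolding h_def using cINF_lower[OF bdd[OF that(2)] that(1)] by simp
  have h_ge: "y \<le> h z" if "\<And>\<eta> K. (\<eta>, K) \<in> L \<Longrightarrow> y \<le> \<eta> + K * z" for z y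
    unfolding h_def using that by (intro cINF_greatest[OF ne]) auto
  have h_nonneg: "h z \<ge> 0" if "z \<ge> 0" for z
    using that by (intro h_ge) (auto simp: L_def)
  have h_mono: "h x \<le> h y" if "0 \<le> x" "x \<le> y" for x y
  proof (rule h_ge)
    fix \<eta> K assume m: "(\<eta>, K) \<in> L"
    have "h x \<le> \<eta> + K * x" using h_le[OF m that(1)] .
    also have "\<dots> \<le> \<eta> + K * y" using m that by (auto simp: L_def mult_left_mono)
    finally show "h x \<le> \<eta> + K * y" .
  qed
  have small: "\<exists>d>0. \<forall>z. 0 \<le> z \<and> z < d \<longrightarrow> h z < e" if "e > 0" for e
  proof -
    obtain K where K: "K \<ge> 0" "(e / 2, K) \<in> L"
      using B[of "e / 2"] \<open>e > 0\<close> by (auto simp: L_def)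
    show ?thesis
    \<comment> \<open>With intercept \<open>e / 2\<close>, this width keeps the linear part below
      \<open>e / 2\<close>; \<open>K + 1\<close> guards against \<open>K = 0\<close>.\<close>
    proof (intro exI[of _ "e / (2 * (K + 1))"] conjI allI impI)
      show "e / (2 * (K + 1)) > 0" using K \<open>e > 0\<close> by simp
      fix z assume z: "0 \<le> z \<and> z < e / (2 * (K + 1))"
      have "h z \<le> e / 2 + K * z" using h_le[OF K(2)] z by simp
      also have "K * z \<le> (K + 1) * z" using z by (simp add: mult_right_mono)
      also have "(K + 1) * z < e / 2" using z K by (simp add: field_simps)
      finally show "h z < e" by simp
    qed
  qed
  have h0: "h 0 = 0"
  proof (rule antisym)
    show "h 0 \<le> 0"
      by (rule field_le_epsilon) (use small in force)
    show "0 \<le> h 0" using h_nonneg by simp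
  qed
  have "convex_on {0<..} (\<lambda>z. - h z)"
  proof (rule convex_onI)
    fix t x y :: real assume txy: "0 < t" "t < 1" "x \<in> {0<..}" "y \<in> {0<..}"
    have "(1 - t) * h x + t * h y \<le> h ((1 - t) *\<^sub>R x + t *\<^sub>R y)"
    proof (rule h_ge)
      fix \<eta> K assume m: "(\<eta>, K) \<in> L"
      have "(1 - t) * h x + t * h y \<le> (1 - t) * (\<eta> + K * x) + t * (\<eta> + K * y)"
        using txy by (intro add_mono mult_left_mono h_le[OF m]) auto
      then show "(1 - t) * h x + t * h y \<le> \<eta> + K * ((1 - t) *\<^sub>R x + t *\<^sub>R y)"
        by (simp add: algebra_simps)
    qed
    then show "- h ((1 - t) *\<^sub>R x + t *\<^sub>R y) \<le> (1 - t) * - h x + t * - h y" by simp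
  qed simp
  then have "continuous_on {0<..} (\<lambda>z. - (- h z))"
    by (intro continuous_on_minus convex_on_continuous) auto
  then have cont_pos: "continuous_on {0<..} h" by simp
  \<comment> \<open>The summand \<open>z\<close> makes the function strictly increasing, and
    \<open>max 0\<close> extends \<open>h\<close> to the negative axis by its value 0 at the
    origin.\<close>
  define \<sigma> where "\<sigma> = (\<lambda>z. z + h (max 0 z))"
  have "continuous_on UNIV (\<lambda>z. h (max 0 z))"
  proof -
    have "isCont (\<lambda>z. h (max 0 z)) x" for x
    proof (cases "x > 0")
      case True
      then have "isCont h x" using cont_pos by (simp add: continuous_on_eq_continuous_at)
      moreover have "isCont (\<lambda>z::real. max 0 z) x" by (intro continuous_intros)
      ultimately show ?thesis using True isCont_o2[of x "\<lambda>z. max 0 z" h] by simp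
    next
      case False
      then have x0: "h (max 0 x) = 0" using h0 by (simp add: max_def)
      show ?thesis
        unfolding continuous_at_eps_delta
      proof (intro allI impI)
        fix e :: real assume "e > 0"
        then obtain d where d: "d > 0" "\<forall>z. 0 \<le> z \<and> z < d \<longrightarrow> h z < e" using small by blast
        show "\<exists>d>0. \<forall>x'. dist x' x < d \<longrightarrow> dist (h (max 0 x')) (h (max 0 x)) < e"
        proof (intro exI[of _ d] conjI allI impI d(1))
          fix x' assume "dist x' x < d"
          then have "max 0 x' < d" using False d(1) by (auto simp: dist_real_def)
          then have "h (max 0 x') < e" using d(2) by simp
          moreover have "h (max 0 x') \<ge> 0" using h_nonneg by simp
          ultimately show "dist (h (max 0 x')) (h (max 0 x)) < e"
            using x0 by (simp add: dist_real_def)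
        qed
      qed
    qed
    then show ?thesis by (simp add: continuous_on_eq_continuous_at)
  qed
  then have "continuous_on UNIV \<sigma>" unfolding \<sigma>_def by (intro continuous_intros)
  moreover have "strict_mono \<sigma>"
  proof (rule strict_monoI)
    fix x y :: real assume "x < y"
    then have "h (max 0 x) \<le> h (max 0 y)" by (intro h_mono) auto
    with \<open>x < y\<close> show "\<sigma> x < \<sigma> y" by (simp add: \<sigma>_def)
  qed
  moreover have "\<sigma> 0 = 0" by (simp add: \<sigma>_def h0)
  ultimately have "gauge_function \<sigma>" unfolding gauge_function_def by simp
  moreover have "v \<le> \<sigma> z" if "(z, v) \<in> B" for z v
  proof -
    have "v \<le> h z" using that by (intro h_ge) (auto simp: L_def)
    then show ?thesis using nonneg[OF that] by (simp add: \<sigma>_def)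
  qed
  ultimately show ?thesis using that by blast
qed

section \<open>Nonflat critical points\<close>

text \<open>Differentiating \<open>inv_into U F \<circ> F\<close>, which is the identity on
  \<open>U\<close>, gives \<open>D' * D = 1\<close>.\<close>

lemma C_diffeo_on_deriv_nonzero:
  assumes "C_diffeo_on (Suc k) F U" "open U" "x \<in> U" and dF: "(F has_real_derivative D) (at x)"
  shows "D \<noteq> 0"
proof -
  have inj: "inj_on F U" using assms(1) by (simp add: C_diffeo_on_def)
  obtain D' where "(inv_into U F has_real_derivative D') (at (F x) within F ` U)"
    using assms(1,3) by (auto simp: C_diffeo_on_def)
  moreover have "(F has_real_derivative D) (at x within U)"
    using dF by (rule has_field_derivative_at_within)
  ultimately have "(inv_into U F \<circ> F has_real_derivative D' * D) (at x within U)"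
    by (rule DERIV_image_chain)
  then have "(inv_into U F \<circ> F has_real_derivative D' * D) (at x)"
    using assms(2,3) at_within_open by metis
  then have "((\<lambda>x. x) has_real_derivative D' * D) (at x)"
    by (rule has_field_derivative_transform_within_open[OF _ assms(2,3)]) (simp add: inj)
  then have "D' * D = 1" using DERIV_ident DERIV_unique by blast
  then show ?thesis by auto
qed

lemma C2_diffeo_obtain_derivs:
  assumes "C_diffeo_on 2 F U" "open U"
  obtains F' F'' where "inj_on F U"
    "\<And>x. x \<in> U \<Longrightarrow> (F has_real_derivative F' x) (at x)"
    "\<And>x. x \<in> U \<Longrightarrow> (F' has_real_derivative F'' x) (at x)"
    "continuous_on U F''" "\<And>x. x \<in> U \<Longrightarrow> F' x \<noteq> 0"
proof -
  from assms(1) have "inj_on F U" "C_on (Suc (Suc 0)) F U"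
    by (simp_all add: C_diffeo_on_def numeral_2_eq_2)
  then obtain F' F'' where
    "\<forall>x\<in>U. (F has_real_derivative F' x) (at x within U)"
    "\<forall>x\<in>U. (F' has_real_derivative F'' x) (at x within U)" "continuous_on U F''"
    by auto
  then show ?thesis
    using that[of F' F''] \<open>inj_on F U\<close> at_within_open[OF _ assms(2)]
      C_diffeo_on_deriv_nonzero[of 1 F U] assms by (simp add: numeral_2_eq_2)
qed

text \<open>The nonlinearity \<open>f'' / f'\<close> splits: the power map contributes a term that
  is singular where \<open>\<Phi>\<close> vanishes, and \<open>\<Phi>\<close> contributes its own
  nonlinearity. Uniqueness of derivatives identifies the given \<open>f'\<close> and
  \<open>f''\<close> with the computed ones.\<close>

lemma power_comp_derivs:
  fixes f \<Phi> :: "real \<Rightarrow> real"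
  assumes W: "open W" "t \<in> W" and "l > 1" "e \<noteq> 0"
    and f: "\<And>x. x \<in> W \<Longrightarrow> f x = e * \<Phi> x powr l + k"
    and pos: "\<And>x. x \<in> W \<Longrightarrow> \<Phi> x > 0"
    and d\<Phi>: "\<And>x. x \<in> W \<Longrightarrow> (\<Phi> has_real_derivative \<Phi>' x) (at x)"
      "\<And>x. x \<in> W \<Longrightarrow> (\<Phi>' has_real_derivative \<Phi>'' x) (at x)"
    and df: "\<And>x. x \<in> W \<Longrightarrow> (f has_real_derivative f' x) (at x)"
      "\<And>x. x \<in> W \<Longrightarrow> (f' has_real_derivative f'' x) (at x)"
    and nz: "\<Phi>' t \<noteq> 0"
  shows "f' t = e * l * \<Phi> t powr (l - 1) * \<Phi>' t"
    and "f'' t / f' t = (l - 1) * \<Phi>' t / \<Phi> t + \<Phi>'' t / \<Phi>' t"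
proof -
  have f': "f' x = e * l * \<Phi> x powr (l - 1) * \<Phi>' x" if "x \<in> W" for x
  proof -
    have "((\<lambda>x. e * \<Phi> x powr l + k) has_real_derivative e * l * \<Phi> x powr (l - 1) * \<Phi>' x) (at x)"
      using pos[OF that] d\<Phi>(1)[OF that]
      by (auto intro!: derivative_eq_intros)
    then have "(f has_real_derivative e * l * \<Phi> x powr (l - 1) * \<Phi>' x) (at x)"
      by (rule has_field_derivative_transform_within_open[OF _ W(1) that]) (simp add: f)
    then show ?thesis using df(1)[OF that] DERIV_unique by blast
  qed
  then show f't: "f' t = e * l * \<Phi> t powr (l - 1) * \<Phi>' t" using W(2) by simp
  have p: "\<Phi> t > 0" using pos W(2) by simp
  have e: "\<Phi> t powr (l - 1) = \<Phi> t powr (l - 2) * \<Phi> t"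
    using p powr_add[of "\<Phi> t" "l - 2" 1] by simp
  have "((\<lambda>x. e * l * \<Phi> x powr (l - 1) * \<Phi>' x) has_real_derivative
      e * l * (((l - 1) * \<Phi> t powr (l - 2) * \<Phi>' t) * \<Phi>' t + \<Phi> t powr (l - 1) * \<Phi>'' t)) (at t)"
    using p d\<Phi>(1,2)[OF W(2)]
    by (auto intro!: derivative_eq_intros simp: algebra_simps)
  then have "(f' has_real_derivative
      e * l * (((l - 1) * \<Phi> t powr (l - 2) * \<Phi>' t) * \<Phi>' t + \<Phi> t powr (l - 1) * \<Phi>'' t)) (at t)"
    by (rule has_field_derivative_transform_within_open[OF _ W]) (simp add: f')
  then have "f'' t = e * l * (((l - 1) * \<Phi> t powr (l - 2) * \<Phi>' t) * \<Phi>' t + \<Phi> t powr (l - 1) * \<Phi>'' t)"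
    using df(2)[OF W(2)] DERIV_unique by blast
  also have "\<dots> = f' t * ((l - 1) * \<Phi>' t / \<Phi> t + \<Phi>'' t / \<Phi>' t)"
    using p nz by (simp add: f't e field_simps)
  finally show "f'' t / f' t = (l - 1) * \<Phi>' t / \<Phi> t + \<Phi>'' t / \<Phi>' t"
    using p nz f't assms(3,4) by simp
qed

text \<open>With \<open>w = \<Phi> s / \<Phi> t\<close>, the difference of the two defects is the
  positive quotient in \<open>quot\<close> times the expression shown nonnegative in
  \<open>power_defect_nonneg\<close>.\<close>

lemma power_comp_defect:
  fixes f \<Phi> :: "real \<Rightarrow> real"
  assumes "l > 1" "e \<noteq> 0" and pos: "\<Phi> t > 0" "\<Phi> s > 0"
    and f: "f s - f t = e * (\<Phi> s powr l - \<Phi> t powr l)"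
    and f': "f' t = e * l * \<Phi> t powr (l - 1) * \<Phi>' t"
    and f'': "f'' t / f' t = (l - 1) * \<Phi>' t / \<Phi> t + \<Phi>'' t / \<Phi>' t"
    and quot: "(s - t) * \<Phi>' t / (\<Phi> s - \<Phi> t) > 0"
  shows "koebe_defect f f' f'' t s \<ge> koebe_defect \<Phi> \<Phi>' \<Phi>'' t s"
proof -
  define w where "w = \<Phi> s / \<Phi> t"
  define q where "q = (s - t) * \<Phi>' t / (\<Phi> s - \<Phi> t)"
  have ne: "\<Phi> s \<noteq> \<Phi> t" using quot by auto
  have w: "w > 0" "w \<noteq> 1" using pos ne by (auto simp: w_def)
  have s: "\<Phi> s = w * \<Phi> t" using pos by (simp add: w_def)
  have wl: "\<Phi> s powr l = w powr l * \<Phi> t powr l" using w pos by (simp add: s powr_mult)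
  have t1: "\<Phi> t powr l = \<Phi> t powr (l - 1) * \<Phi> t"
    using pos powr_add[of "\<Phi> t" "l - 1" 1] by simp
  have "w powr l \<noteq> 1"
  proof
    assume "w powr l = 1"
    then have "w = 1" using w assms(1) by (auto simp: powr_def)
    with w show False by simp
  qed
  have t2: "(s - t) * \<Phi>' t = q * (w - 1) * \<Phi> t"
    using ne by (simp add: q_def s algebra_simps) (simp add: field_simps)
  have A: "(s - t) * f'' t / f' t = q * ((l - 1) * (w - 1)) + (s - t) * \<Phi>'' t / \<Phi>' t"
  proof -
    have "(s - t) * f'' t / f' t = (l - 1) * ((s - t) * \<Phi>' t) / \<Phi> t + (s - t) * \<Phi>'' t / \<Phi>' t"
      using f'' by (metis (no_types, lifting) distrib_left mult.left_commute times_divide_eq_right)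
    then show ?thesis using pos unfolding t2 by simp
  qed
  have B: "2 * (s - t) * f' t / (f s - f t) = q * (2 * l * (w - 1) / (w powr l - 1))"
  proof -
    have "2 * (s - t) * f' t = 2 * e * l * \<Phi> t powr (l - 1) * ((s - t) * \<Phi>' t)"
      by (simp add: f')
    also have "\<dots> = (e * \<Phi> t powr l) * (q * (2 * l * (w - 1)))"
      unfolding t2 t1 by simp
    finally have 1: "2 * (s - t) * f' t = (e * \<Phi> t powr l) * (q * (2 * l * (w - 1)))" .
    have 2: "f s - f t = (e * \<Phi> t powr l) * (w powr l - 1)"
      unfolding f wl by (simp add: algebra_simps)
    have "e * \<Phi> t powr l \<noteq> 0" using assms(2) pos by simp
    then show ?thesis unfolding 1 2 by (simp add: mult_divide_mult_cancel_left)
  qed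
  have "koebe_defect f f' f'' t s - koebe_defect \<Phi> \<Phi>' \<Phi>'' t s =
      q * ((l - 1) * (w - 1) + 2 * l * (w - 1) / (w powr l - 1) - 2)"
  proof -
    have "2 * (s - t) * \<Phi>' t / (\<Phi> s - \<Phi> t) = 2 * q" by (simp add: q_def)
    then show ?thesis unfolding koebe_defect_def A B by (simp add: algebra_simps)
  qed
  also have "\<dots> \<ge> 0"
    using power_defect_nonneg[OF assms(1) w] quot by (intro mult_nonneg_nonneg) (auto simp: q_def)
  finally show ?thesis by simp
qed

section \<open>Interval maps with nonflat critical points\<close>

locale nonflat_interval_map =
  fixes f f' f'' :: "real \<Rightarrow> real" and a b :: real
  assumes maps: "x \<in> {a..b} \<Longrightarrow> f x \<in> {a..b}"
    and deriv_within: "x \<in> {a..b} \<Longrightarrow> (f has_real_derivative f' x) (at x within {a..b})"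
      "x \<in> {a..b} \<Longrightarrow> (f' has_real_derivative f'' x) (at x within {a..b})"
    and continuous_deriv2: "continuous_on {a..b} f''"
    and nonflat_critical: "c \<in> {a..b} \<Longrightarrow> f' c = 0 \<Longrightarrow> nonflat 2 f {a..b} c"
begin

text \<open>The open interval makes all derivatives two-sided. The segment avoids critical points
  but may come arbitrarily close to them, so the bounds below have to be uniform over all such
  pairs.\<close>

definition regular :: "real \<Rightarrow> real \<Rightarrow> bool" where
  "regular t s \<longleftrightarrow>
     t \<noteq> s \<and> closed_segment t s \<subseteq> {a<..<b} \<and> (\<forall>x\<in>closed_segment t s. f' x \<noteq> 0)"

lemma deriv_interior:
  assumes "x \<in> {a<..<b}"
  shows "(f has_real_derivative f' x) (at x)" "(f' has_real_derivative f'' x) (at x)"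
  using deriv_within[of x] assms at_within_Icc_at[of a x b] by auto

lemma continuous_f: "continuous_on {a..b} f"
  and continuous_deriv: "continuous_on {a..b} f'"
  using deriv_within DERIV_continuous_on by blast+

lemma regular_derivs:
  assumes "regular t s" "x \<in> closed_segment t s"
  shows "(f has_real_derivative f' x) (at x)" "(f' has_real_derivative f'' x) (at x)" "f' x \<noteq> 0"
  using assms deriv_interior unfolding regular_def by blast+

lemma regular_quotient_pos:
  assumes "regular t s"
  shows "(s - t) * f' t / (f s - f t) > 0"
proof (rule difference_quotient_pos)
  show "continuous_on (closed_segment t s) f'"
    using assms by (intro continuous_on_subset[OF continuous_deriv]) (auto simp: regular_def)
qed (use assms regular_derivs in \<open>auto simp: regular_def\<close>)

section \<open>Local lower bounds for the defect and their globalisation\<close>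

text \<open>Near \<open>c\<close> the derivative is at least \<open>m\<close> in absolute value, and
  the modulus of \<open>f''\<close> is taken with tolerance \<open>\<eta> * m\<close>, so that
  dividing by \<open>m\<close> leaves \<open>\<eta>\<close>. Only \<open>t\<close> is localised: the
  modulus holds on all of \<open>{a..b}\<close>, so \<open>s\<close> may be far away.\<close>

lemma local_bound_noncritical:
  assumes "c \<in> {a..b}" "f' c \<noteq> 0" "\<eta> > 0"
  shows "\<exists>r>0. \<exists>K. \<forall>t\<in>{a..b}. dist c t < r \<longrightarrow>
    (\<forall>s. regular t s \<longrightarrow> koebe_defect f f' f'' t s \<ge> - (\<bar>s - t\<bar> * (\<eta> + K * \<bar>s - t\<bar>)))"
proof -
  define m where "m = \<bar>f' c\<bar> / 2"
  have m: "m > 0" using assms by (simp add: m_def)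
  obtain r where r: "r > 0" "\<And>t. t \<in> {a..b} \<Longrightarrow> dist t c < r \<Longrightarrow> dist (f' t) (f' c) < m"
    using continuous_deriv assms(1) m unfolding continuous_on_iff by metis
  obtain K where K: "K \<ge> 0"
    "\<And>x y. x \<in> {a..b} \<Longrightarrow> y \<in> {a..b} \<Longrightarrow> \<bar>f'' x - f'' y\<bar> \<le> \<eta> * m + K * \<bar>x - y\<bar>"
    using continuous_linear_modulus[OF compact_Icc continuous_deriv2, of "\<eta> * m"] m assms(3)
    by auto
  show ?thesis
  proof (rule exI[of _ r], rule conjI[OF r(1)], rule exI[of _ "K / m"], intro ballI impI allI)
    fix t s assume t: "t \<in> {a..b}" "dist c t < r" and reg: "regular t s"
    have ft: "\<bar>f' t\<bar> \<ge> m"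
    proof -
      have "dist (f' t) (f' c) < m" using r(2)[OF t(1)] t(2) by (simp add: dist_commute)
      then show ?thesis unfolding dist_real_def m_def by linarith
    qed
    have "t \<noteq> s" using reg by (simp add: regular_def)
    then obtain \<xi> where \<xi>: "\<xi> \<in> closed_segment t s"
      "koebe_defect f f' f'' t s \<ge> - (\<bar>s - t\<bar> * (\<bar>f'' \<xi> - f'' t\<bar> / \<bar>f' t\<bar>))"
      using koebe_defect_lower_bound[of t s f f' f''] regular_derivs[OF reg] by blast
    have "\<bar>\<xi> - t\<bar> \<le> \<bar>s - t\<bar>"
      using \<xi>(1) by (auto simp: closed_segment_eq_real_ivl split: if_splits)
    have "\<xi> \<in> {a..b}" using \<xi>(1) reg by (force simp: regular_def)
    then have "\<bar>f'' \<xi> - f'' t\<bar> \<le> \<eta> * m + K * \<bar>\<xi> - t\<bar>" using K(2) t(1) by blast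
    also have "\<dots> \<le> \<eta> * m + K * \<bar>s - t\<bar>"
      using \<open>\<bar>\<xi> - t\<bar> \<le> \<bar>s - t\<bar>\<close> K(1) by (simp add: mult_left_mono)
    finally have "\<bar>f'' \<xi> - f'' t\<bar> / \<bar>f' t\<bar> \<le> (\<eta> * m + K * \<bar>s - t\<bar>) / m"
      using ft m by (intro frac_le) auto
    also have "\<dots> = \<eta> + K / m * \<bar>s - t\<bar>" using m by (simp add: field_simps)
    finally have "\<bar>s - t\<bar> * (\<bar>f'' \<xi> - f'' t\<bar> / \<bar>f' t\<bar>) \<le> \<bar>s - t\<bar> * (\<eta> + K / m * \<bar>s - t\<bar>)"
      by (rule mult_left_mono) simp
    with \<xi>(2) show "koebe_defect f f' f'' t s \<ge> - (\<bar>s - t\<bar> * (\<eta> + K / m * \<bar>s - t\<bar>))"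
      by linarith
  qed
qed

text \<open>If \<open>s\<close> is close to \<open>t\<close>, both lie on one side of
  \<open>c\<close> within the normal form, and the estimate reduces to the nonsingular chart
  \<open>\<Phi>\<close>. Otherwise \<open>\<bar>s - t\<bar>\<close> is bounded below, and a large
  slope pays for the constant 2 in the defect.\<close>

lemma local_bound_critical:
  assumes c: "c \<in> {a..b}" "f' c = 0" and "\<eta> > 0"
  shows "\<exists>r>0. \<exists>K. \<forall>t\<in>{a..b}. dist c t < r \<longrightarrow>
    (\<forall>s. regular t s \<longrightarrow> koebe_defect f f' f'' t s \<ge> - (\<bar>s - t\<bar> * (\<eta> + K * \<bar>s - t\<bar>)))"
proof -
  obtain l U \<phi> where l: "l > 1" and U: "open U" "c \<in> U" and diffeo: "C_diffeo_on 2 \<phi> U"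
    and nf: "\<And>x. x \<in> U \<inter> {a..b} \<Longrightarrow>
      f x = \<bar>\<phi> x\<bar> powr l + f c \<or> f x = - (\<bar>\<phi> x\<bar> powr l) + f c"
    using nonflat_critical[OF c] unfolding nonflat_def by blast
  obtain \<phi>' \<phi>'' where inj: "inj_on \<phi> U"
    and d\<phi>: "\<And>x. x \<in> U \<Longrightarrow> (\<phi> has_real_derivative \<phi>' x) (at x)"
      "\<And>x. x \<in> U \<Longrightarrow> (\<phi>' has_real_derivative \<phi>'' x) (at x)"
    and cont\<phi>'': "continuous_on U \<phi>''" and nz: "\<And>x. x \<in> U \<Longrightarrow> \<phi>' x \<noteq> 0"
    using C2_diffeo_obtain_derivs[OF diffeo U(1)] by blast
  have cont\<phi>: "continuous_on U \<phi>" and cont\<phi>': "continuous_on U \<phi>'"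
    using d\<phi> by (meson DERIV_continuous continuous_at_imp_continuous_on)+
  have \<phi>c: "\<phi> c = 0" using nf[of c] U c by auto
  have \<phi>nz: "\<phi> x \<noteq> 0" if "x \<in> U" "x \<noteq> c" for x
    using inj that U \<phi>c by (metis inj_onD)
  obtain \<delta> where \<delta>: "\<delta> > 0" "cball c \<delta> \<subseteq> U" using U open_contains_cball by blast
  define X where "X = cball c \<delta>"
  have X: "compact X" "X \<noteq> {}" "X \<subseteq> U" using \<delta> by (auto simp: X_def)
  obtain x0 where x0: "x0 \<in> X" "\<And>x. x \<in> X \<Longrightarrow> \<bar>\<phi>' x0\<bar> \<le> \<bar>\<phi>' x\<bar>"
    using continuous_attains_inf[OF X(1,2), of "\<lambda>x. \<bar>\<phi>' x\<bar>"]
      continuous_on_subset[OF cont\<phi>' X(3)] by (auto intro: continuous_intros)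
  define m where "m = \<bar>\<phi>' x0\<bar>"
  have m: "m > 0" "\<And>x. x \<in> X \<Longrightarrow> m \<le> \<bar>\<phi>' x\<bar>" using x0 nz X by (auto simp: m_def)
  have "continuous_on X (\<lambda>x. \<bar>\<phi>'' x / \<phi>' x\<bar>)"
    using continuous_on_subset[OF cont\<phi>' X(3)] continuous_on_subset[OF cont\<phi>'' X(3)] nz X
    by (intro continuous_intros) auto
  then obtain x1 where x1: "x1 \<in> X" "\<And>x. x \<in> X \<Longrightarrow> \<bar>\<phi>'' x / \<phi>' x\<bar> \<le> \<bar>\<phi>'' x1 / \<phi>' x1\<bar>"
    using continuous_attains_sup[OF X(1,2)] by blast
  define M where "M = \<bar>\<phi>'' x1 / \<phi>' x1\<bar>"
  have M: "M \<ge> 0" "\<And>x. x \<in> X \<Longrightarrow> \<bar>\<phi>'' x / \<phi>' x\<bar> \<le> M" using x1 by (auto simp: M_def)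
  obtain K0 where K0: "K0 \<ge> 0"
    "\<And>x y. x \<in> X \<Longrightarrow> y \<in> X \<Longrightarrow> \<bar>\<phi>'' x - \<phi>'' y\<bar> \<le> \<eta> * m + K0 * \<bar>x - y\<bar>"
    using continuous_linear_modulus[OF X(1) continuous_on_subset[OF cont\<phi>'' X(3)], of "\<eta> * m"]
      m assms(3) by auto
  \<comment> \<open>When \<open>\<bar>s - t\<bar>\<close> is at least \<open>\<delta> / 2\<close>,
    the first factor covers the nonlinearity of \<open>\<phi>\<close> and the constant 2 of the
    defect, and the second supplies one more power of \<open>\<bar>s - t\<bar>\<close>.\<close>
  define K1 where "K1 = (M + 4 / \<delta>) * (2 / \<delta>)"
  have K1: "K1 \<ge> 0" using M \<delta> by (simp add: K1_def)
  show ?thesis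
  proof (rule exI[of _ "\<delta> / 2"], rule conjI, simp add: \<delta>(1),
      rule exI[of _ "K0 / m + K1"], intro ballI impI allI)
    fix t s assume t: "t \<in> {a..b}" "dist c t < \<delta> / 2" and reg: "regular t s"
    have ts: "t \<noteq> s" "t \<in> {a<..<b}" "s \<in> {a<..<b}" and c_notin: "c \<notin> closed_segment t s"
      using reg c by (auto simp: regular_def)
    have tc: "t \<noteq> c" using c_notin by auto
    \<comment> \<open>A one-sided neighbourhood of \<open>c\<close> containing \<open>t\<close>. On
      it \<open>\<phi>\<close> and \<open>f - f c\<close> have no zeros, so the pointwise sign in
      \<open>nonflat\<close> becomes the constant \<open>e\<close>, and \<open>\<tau>\<close> makes
      the base of the power positive.\<close>
    define W where "W = ball c \<delta> \<inter> {a<..<b} \<inter> (if t < c then {..<c} else {c<..})"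
    have W: "open W" "convex W" "t \<in> W" "W \<subseteq> X" "c \<notin> W" "W \<subseteq> {a<..<b}"
      using t ts tc \<delta> by (auto simp: W_def X_def intro!: convex_Int open_Int)
    have WU: "x \<in> U" if "x \<in> W" for x using that W(4) X(3) by blast
    have W\<phi>: "\<phi> x \<noteq> 0" if "x \<in> W" for x using \<phi>nz WU W(5) that by blast
    define \<tau> where "\<tau> = sgn (\<phi> t)"
    define e where "e = sgn (f t - f c)"
    have \<tau>: "\<bar>\<tau>\<bar> = 1" using W\<phi>[OF W(3)] by (simp add: \<tau>_def abs_sgn_eq)
    have \<tau>pos: "\<tau> * \<phi> x > 0" if "x \<in> W" for x
    proof -
      have "\<phi> t * \<phi> x > 0"
        using W\<phi> W(3) that WU continuous_on_subset[OF cont\<phi>, of W]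
        by (intro connected_nonzero_same_sign[OF convex_connected[OF W(2)]]) auto
      then show ?thesis by (auto simp: \<tau>_def sgn_if zero_less_mult_iff)
    qed
    have fnz: "f x - f c \<noteq> 0" if "x \<in> W" for x
      using nf[of x] W\<phi>[OF that] that WU W(6) by force
    have fW: "f x = e * (\<tau> * \<phi> x) powr l + f c" if "x \<in> W" for x
    proof -
      have cont: "continuous_on W (\<lambda>x. f x - f c)"
        using W(6) by (intro continuous_intros continuous_on_subset[OF continuous_f]) auto
      have "(f t - f c) * (f x - f c) > 0"
        by (rule connected_nonzero_same_sign[OF convex_connected[OF W(2)] cont fnz W(3) that])
      then have sg: "e * (f x - f c) > 0" and e: "e = 1 \<or> e = -1"
        by (auto simp: e_def sgn_if zero_less_mult_iff split: if_splits)
      have "\<tau> * \<phi> x = \<bar>\<phi> x\<bar>"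
        using \<tau>pos[OF that] \<tau> by (metis abs_mult abs_of_pos mult_1)
      moreover have "\<bar>\<phi> x\<bar> powr l > 0" using W\<phi>[OF that] by simp
      moreover have "f x = \<bar>\<phi> x\<bar> powr l + f c \<or> f x = - (\<bar>\<phi> x\<bar> powr l) + f c"
        using nf[of x] that WU W(6) by force
      ultimately show ?thesis using sg e by auto
    qed
    have e0: "e \<noteq> 0" using fnz[OF W(3)] by (simp add: e_def sgn_if)
    define \<Phi> \<Phi>' \<Phi>'' where "\<Phi> = (\<lambda>x. \<tau> * \<phi> x)" and "\<Phi>' = (\<lambda>x. \<tau> * \<phi>' x)"
      and "\<Phi>'' = (\<lambda>x. \<tau> * \<phi>'' x)"
    have d\<Phi>: "(\<Phi> has_real_derivative \<Phi>' x) (at x)" "(\<Phi>' has_real_derivative \<Phi>'' x) (at x)"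
      if "x \<in> W" for x
      using d\<phi>[OF WU[OF that]] unfolding \<Phi>_def \<Phi>'_def \<Phi>''_def by (auto intro: DERIV_cmult)
    have \<Phi>nz: "\<Phi>' x \<noteq> 0" if "x \<in> W" for x
      using nz[OF WU[OF that]] \<tau> by (auto simp: \<Phi>'_def)
    have \<Phi>pos: "\<Phi> x > 0" if "x \<in> W" for x using \<tau>pos[OF that] by (simp add: \<Phi>_def)
    have f\<Phi>: "f x = e * \<Phi> x powr l + f c" if "x \<in> W" for x using fW[OF that] by (simp add: \<Phi>_def)
    have fd: "(f has_real_derivative f' x) (at x)" "(f' has_real_derivative f'' x) (at x)"
      if "x \<in> W" for x using deriv_interior that W(6) by blast+
    note comp = power_comp_derivs[OF W(1,3) l e0 f\<Phi> \<Phi>pos d\<Phi> fd \<Phi>nz[OF W(3)]]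
    show "koebe_defect f f' f'' t s \<ge> - (\<bar>s - t\<bar> * (\<eta> + (K0 / m + K1) * \<bar>s - t\<bar>))"
    proof (cases "\<bar>s - t\<bar> < \<delta> / 2")
      case True
      \<comment> \<open>Since \<open>t\<close> is within \<open>\<delta> / 2\<close> of
        \<open>c\<close>, the point \<open>s\<close> is within \<open>\<delta>\<close>; it cannot be
        across \<open>c\<close> because the segment misses \<open>c\<close>.\<close>
      have sW: "s \<in> W"
        using True t(2) ts tc c_notin unfolding W_def
        by (auto simp: dist_real_def closed_segment_eq_real_ivl split: if_splits)
      have seg: "closed_segment t s \<subseteq> W"
        using W(2,3) sW by (simp add: closed_segment_subset)
      have "continuous_on (closed_segment t s) \<Phi>'"
        using d\<Phi>(2) seg by (meson DERIV_continuous continuous_at_imp_continuous_on subsetD)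
      then have "(s - t) * \<Phi>' t / (\<Phi> s - \<Phi> t) > 0"
        using d\<Phi>(1) \<Phi>nz seg by (intro difference_quotient_pos[OF ts(1)]) auto
      then have 1: "koebe_defect f f' f'' t s \<ge> koebe_defect \<Phi> \<Phi>' \<Phi>'' t s"
        using comp f\<Phi>[OF W(3)] f\<Phi>[OF sW] \<Phi>pos[OF W(3)] \<Phi>pos[OF sW]
        by (intro power_comp_defect[OF l e0]) (auto simp: algebra_simps)
      obtain \<xi> where \<xi>: "\<xi> \<in> closed_segment t s"
        "koebe_defect \<Phi> \<Phi>' \<Phi>'' t s \<ge> - (\<bar>s - t\<bar> * (\<bar>\<Phi>'' \<xi> - \<Phi>'' t\<bar> / \<bar>\<Phi>' t\<bar>))"
        using koebe_defect_lower_bound[OF ts(1), of \<Phi> \<Phi>' \<Phi>''] d\<Phi> \<Phi>nz seg by blast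
      have "\<bar>\<xi> - t\<bar> \<le> \<bar>s - t\<bar>"
        using \<xi>(1) by (auto simp: closed_segment_eq_real_ivl split: if_splits)
      have tX: "t \<in> X" "\<xi> \<in> X" using W(3,4) seg \<xi>(1) by blast+
      have "\<bar>\<Phi>'' \<xi> - \<Phi>'' t\<bar> / \<bar>\<Phi>' t\<bar> = \<bar>\<phi>'' \<xi> - \<phi>'' t\<bar> / \<bar>\<phi>' t\<bar>"
        unfolding \<Phi>''_def \<Phi>'_def right_diff_distrib[symmetric] abs_mult \<tau> by simp
      also have "\<dots> \<le> (\<eta> * m + K0 * \<bar>\<xi> - t\<bar>) / m"
        using K0(2)[OF tX(2,1)] m(1) m(2)[OF tX(1)] by (intro frac_le) auto
      also have "\<dots> \<le> (\<eta> * m + K0 * \<bar>s - t\<bar>) / m"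
        using \<open>\<bar>\<xi> - t\<bar> \<le> \<bar>s - t\<bar>\<close> m(1) K0(1) by (intro divide_right_mono add_left_mono mult_left_mono) auto
      also have "\<dots> = \<eta> + K0 / m * \<bar>s - t\<bar>" using m(1) by (simp add: field_simps)
      also have "\<dots> \<le> \<eta> + (K0 / m + K1) * \<bar>s - t\<bar>" using K1 by (simp add: distrib_right)
      finally have "\<bar>s - t\<bar> * (\<bar>\<Phi>'' \<xi> - \<Phi>'' t\<bar> / \<bar>\<Phi>' t\<bar>) \<le> \<bar>s - t\<bar> * (\<eta> + (K0 / m + K1) * \<bar>s - t\<bar>)"
        by (rule mult_left_mono) simp
      with 1 \<xi>(2) show ?thesis by linarith
    next
      case False
      text \<open>Here \<open>s\<close> lies on the side of \<open>t\<close> away from \<open>c\<close>, where the singular part of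
        \<open>f'' / f'\<close> has a favourable sign.\<close>
      then have away: "(s - t) * (t - c) \<ge> 0"
        using t(2) c_notin ts(1) tc
        by (auto simp: dist_real_def closed_segment_eq_real_ivl zero_le_mult_iff split: if_splits)
      have segc: "closed_segment t c \<subseteq> U"
        using W(3,4) \<delta> by (intro order.trans[OF closed_segment_subset[of _ X]])
          (auto simp: X_def)
      \<comment> \<open>As \<open>\<phi> c = 0\<close>, positivity of this quotient says that
        \<open>\<phi>' t / \<phi> t\<close> has the sign of \<open>t - c\<close>, which by
        \<open>away\<close> is that of \<open>s - t\<close>.\<close>
      have "(c - t) * \<phi>' t / (\<phi> c - \<phi> t) > 0"
        using d\<phi>(1) nz segc continuous_on_subset[OF cont\<phi>' segc]
        by (intro difference_quotient_pos[OF tc]) auto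
      define q where "q = \<phi>' t / \<phi> t"
      have "(c - t) * \<phi>' t / (\<phi> c - \<phi> t) = (t - c) * q"
        by (simp add: \<phi>c q_def left_diff_distrib diff_divide_distrib)
      with \<open>(c - t) * \<phi>' t / (\<phi> c - \<phi> t) > 0\<close> have "(t - c) * q > 0" by simp
      with away have "(s - t) * q \<ge> 0"
        by (auto simp: zero_le_mult_iff zero_less_mult_iff)
      then have "(l - 1) * ((s - t) * q) \<ge> 0"
        by (rule mult_nonneg_nonneg[rotated]) (use l in simp)
      moreover have "(l - 1) * ((s - t) * q) = (s - t) * ((l - 1) * \<phi>' t / \<phi> t)"
        unfolding q_def times_divide_eq_right by (simp only: mult.left_commute)
      ultimately have sing: "(s - t) * ((l - 1) * \<phi>' t / \<phi> t) \<ge> 0" by simp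
      have \<tau>0: "\<tau> \<noteq> 0" using \<tau> by auto
      have ratio: "f'' t / f' t = (l - 1) * \<phi>' t / \<phi> t + \<phi>'' t / \<phi>' t"
        using comp(2) \<tau>0 by (simp add: \<Phi>_def \<Phi>'_def \<Phi>''_def)
      \<comment> \<open>The difference quotient term is positive and is discarded, leaving the
        constant -2.\<close>
      have "koebe_defect f f' f'' t s \<ge> (s - t) * (f'' t / f' t) - 2"
      proof -
        have "2 * (s - t) * f' t / (f s - f t) = 2 * ((s - t) * f' t / (f s - f t))" by simp
        then show ?thesis using regular_quotient_pos[OF reg]
          unfolding koebe_defect_def times_divide_eq_right by linarith
      qed
      moreover have "(s - t) * (f'' t / f' t) = (s - t) * ((l - 1) * \<phi>' t / \<phi> t) + (s - t) * (\<phi>'' t / \<phi>' t)"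
        by (simp only: ratio distrib_left)
      ultimately have "koebe_defect f f' f'' t s \<ge> (s - t) * (\<phi>'' t / \<phi>' t) - 2"
        using sing by linarith
      moreover have "- (\<bar>s - t\<bar> * M) \<le> (s - t) * (\<phi>'' t / \<phi>' t)"
      proof -
        have "\<bar>(s - t) * (\<phi>'' t / \<phi>' t)\<bar> \<le> \<bar>s - t\<bar> * M"
          unfolding abs_mult[of "s - t"] using M(2) W(3,4) by (intro mult_left_mono) auto
        then show ?thesis by (simp only: abs_le_iff minus_le_iff)
      qed
      moreover have "2 \<le> \<bar>s - t\<bar> * (4 / \<delta>)"
        using False \<delta>(1) by (simp add: field_simps)
      ultimately have "koebe_defect f f' f'' t s \<ge> - (\<bar>s - t\<bar> * (M + 4 / \<delta>))"
        unfolding distrib_left by linarith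
      moreover have "\<bar>s - t\<bar> * (M + 4 / \<delta>) \<le> \<bar>s - t\<bar> * (K1 * \<bar>s - t\<bar>)"
      proof (rule mult_left_mono)
        have "2 / \<delta> * (\<delta> / 2) \<le> 2 / \<delta> * \<bar>s - t\<bar>"
          using False \<delta>(1) by (intro mult_left_mono) auto
        then have "1 \<le> 2 / \<delta> * \<bar>s - t\<bar>" using \<delta>(1) by simp
        then have "(M + 4 / \<delta>) * 1 \<le> (M + 4 / \<delta>) * (2 / \<delta> * \<bar>s - t\<bar>)"
          using M(1) \<delta>(1) by (intro mult_left_mono) auto
        then show "M + 4 / \<delta> \<le> K1 * \<bar>s - t\<bar>"
          unfolding K1_def by (simp only: mult_1_right mult.assoc)
      qed simp
      moreover have "\<bar>s - t\<bar> * (K1 * \<bar>s - t\<bar>) \<le> \<bar>s - t\<bar> * (\<eta> + (K0 / m + K1) * \<bar>s - t\<bar>)"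
      proof (rule mult_left_mono)
        have "K0 / m * \<bar>s - t\<bar> \<ge> 0" using m(1) K0(1) by simp
        then show "K1 * \<bar>s - t\<bar> \<le> \<eta> + (K0 / m + K1) * \<bar>s - t\<bar>"
          unfolding distrib_right using assms(3) by linarith
      qed simp
      ultimately show ?thesis by (meson neg_le_iff_le order_trans)
    qed
  qed
qed

text \<open>For each \<open>\<eta>\<close>, compactness merges the local bounds into one
  \<open>K\<close> on \<open>{a..b}\<close>. This is the hypothesis of \<open>gauge_majorant\<close>
  for the set \<open>B\<close> of lengths paired with normalised negative defects.\<close>

lemma koebe_defect_gauge:
  obtains \<sigma> where "gauge_function \<sigma>"
    "\<And>t s. regular t s \<Longrightarrow> koebe_defect f f' f'' t s \<ge> - (\<bar>s - t\<bar> * \<sigma> \<bar>s - t\<bar>)"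
proof -
  define B where "B = {(\<bar>s - t\<bar>, - koebe_defect f f' f'' t s / \<bar>s - t\<bar>) | t s. regular t s}"
  have "\<exists>K\<ge>0. \<forall>(z, v)\<in>B. v \<le> \<eta> + K * z" if pos: "\<eta> > 0" for \<eta>
  proof -
    define P where "P = (\<lambda>t K. \<forall>s. regular t s \<longrightarrow>
      koebe_defect f f' f'' t s \<ge> - (\<bar>s - t\<bar> * (\<eta> + K * \<bar>s - t\<bar>)))"
    have loc: "\<exists>r>0. \<exists>K. \<forall>t\<in>{a..b}. dist c t < r \<longrightarrow> P t K" if "c \<in> {a..b}" for c
      unfolding P_def
      using local_bound_critical[OF that _ pos] local_bound_noncritical[OF that _ pos]
      by (cases "f' c = 0") simp_all
    have mono: "P t K'" if P: "P t K" and "K \<le> K'" for t K K'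
      unfolding P_def
    proof (intro allI impI)
      fix s assume "regular t s"
      then have "- (\<bar>s - t\<bar> * (\<eta> + K * \<bar>s - t\<bar>)) \<le> koebe_defect f f' f'' t s"
        using P by (simp add: P_def)
      moreover have "\<bar>s - t\<bar> * (\<eta> + K * \<bar>s - t\<bar>) \<le> \<bar>s - t\<bar> * (\<eta> + K' * \<bar>s - t\<bar>)"
        using \<open>K \<le> K'\<close> by (intro mult_left_mono add_left_mono mult_right_mono) auto
      ultimately show "- (\<bar>s - t\<bar> * (\<eta> + K' * \<bar>s - t\<bar>)) \<le> koebe_defect f f' f'' t s"
        by linarith
    qed
    obtain K where K: "K \<ge> 0" "\<And>t. t \<in> {a..b} \<Longrightarrow> P t K"
      by (rule compact_uniform_bound[OF compact_Icc, of a b P]) (use loc mono in fast)+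
    have "- koebe_defect f f' f'' t s / \<bar>s - t\<bar> \<le> \<eta> + K * \<bar>s - t\<bar>" if "regular t s" for t s
    proof -
      have "t \<noteq> s" "t \<in> {a..b}" using that by (auto simp: regular_def)
      then have "- (\<bar>s - t\<bar> * (\<eta> + K * \<bar>s - t\<bar>)) \<le> koebe_defect f f' f'' t s"
        using K(2) that by (simp add: P_def)
      then have "- koebe_defect f f' f'' t s \<le> (\<eta> + K * \<bar>s - t\<bar>) * \<bar>s - t\<bar>"
        by (simp only: mult.commute minus_le_iff)
      with \<open>t \<noteq> s\<close> show ?thesis by (subst pos_divide_le_eq) auto
    qed
    then show ?thesis using K(1) by (auto simp: B_def)
  qed
  moreover have "z \<ge> 0" if "(z, v) \<in> B" for z v using that by (auto simp: B_def)
  ultimately obtain \<sigma> where \<sigma>: "gauge_function \<sigma>" "\<And>z v. (z, v) \<in> B \<Longrightarrow> v \<le> \<sigma> z"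
    using gauge_majorant[of B] by metis
  show ?thesis
  proof (rule that[OF \<sigma>(1)])
    fix t s assume reg: "regular t s"
    then have "- koebe_defect f f' f'' t s / \<bar>s - t\<bar> \<le> \<sigma> \<bar>s - t\<bar>" by (intro \<sigma>(2)) (auto simp only: B_def)
    moreover have "\<bar>s - t\<bar> > 0" using reg by (simp add: regular_def)
    ultimately have "- koebe_defect f f' f'' t s \<le> \<sigma> \<bar>s - t\<bar> * \<bar>s - t\<bar>"
      by (simp only: pos_divide_le_eq)
    then show "koebe_defect f f' f'' t s \<ge> - (\<bar>s - t\<bar> * \<sigma> \<bar>s - t\<bar>)"
      by (simp only: mult.commute minus_le_iff)
  qed
qed

end

section \<open>Distortion of iterates\<close>

text \<open>The derivative is a separate parameter, so that an iterate can be paired with its chain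
  rule product.\<close>

definition koebe_ratio :: "(real \<Rightarrow> real) \<Rightarrow> (real \<Rightarrow> real) \<Rightarrow> real \<Rightarrow> real \<Rightarrow> real \<Rightarrow> real" where
  "koebe_ratio F F' q r s =
     F' r / F' q * ((F s - F q) / (F s - F r))\<^sup>2 * ((s - r) / (s - q))\<^sup>2"

context nonflat_interval_map
begin

text \<open>The logarithm \<open>G\<close> of the ratio, as a function of the middle point, has the
  defect divided by \<open>s - x\<close> as derivative; the mean value theorem from \<open>q\<close>
  to \<open>r\<close> turns the pointwise bound into one for \<open>G r\<close>.\<close>

lemma koebe_ratio_step:
  assumes \<sigma>: "gauge_function \<sigma>"
    "\<And>t s. regular t s \<Longrightarrow> koebe_defect f f' f'' t s \<ge> - (\<bar>s - t\<bar> * \<sigma> \<bar>s - t\<bar>)"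
    and reg: "regular q s" and r: "r \<in> open_segment q s"
  shows "koebe_ratio f f' q r s \<ge> exp (- (\<sigma> \<bar>s - q\<bar> * \<bar>r - q\<bar>))"
proof -
  have sub: "regular x s" "0 < (s - x) / (s - q)" "0 < f' x / f' q"
    "0 < (f s - f x) / (f s - f q)" if x: "x \<in> closed_segment q r" for x
  proof -
    have xs: "x \<in> closed_segment q s" "x \<noteq> s"
      using x r by (auto simp: closed_segment_eq_real_ivl open_segment_eq_real_ivl split: if_splits)
    then have "closed_segment x s \<subseteq> closed_segment q s"
      by (simp add: subset_closed_segment)
    with xs reg show "regular x s" unfolding regular_def by blast
    show 1: "0 < (s - x) / (s - q)"
      using x r by (auto simp: closed_segment_eq_real_ivl open_segment_eq_real_ivl
          zero_less_divide_iff split: if_splits)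
    have "continuous_on (closed_segment q s) f'"
      using reg by (intro continuous_on_subset[OF continuous_deriv]) (auto simp: regular_def)
    then have "f' x * f' q > 0"
      using reg xs by (intro connected_nonzero_same_sign[of "closed_segment q s"])
        (auto simp: regular_def)
    then show 2: "0 < f' x / f' q" by (auto simp: zero_less_divide_iff zero_less_mult_iff)
    \<comment> \<open>Dividing two positive difference quotients isolates the sign of the remaining
      ratio, that of the increments of \<open>f\<close>.\<close>
    have "0 < ((s - x) * f' x / (f s - f x)) / ((s - q) * f' q / (f s - f q))"
      by (intro divide_pos_pos regular_quotient_pos \<open>regular x s\<close> reg)
    also have "\<dots> = ((s - x) / (s - q)) * (f' x / f' q) * ((f s - f q) / (f s - f x))" by simp
    finally have "0 < (f s - f q) / (f s - f x)"
      using 1 2 by (metis mult_pos_pos zero_less_mult_pos)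
    then show "0 < (f s - f x) / (f s - f q)" by (auto simp: zero_less_divide_iff)
  qed
  \<comment> \<open>Normalising by the values at \<open>q\<close> keeps the argument of every
    logarithm positive in either orientation and makes \<open>G q = 0\<close>.\<close>
  define G where "G = (\<lambda>x. ln (f' x / f' q) + 2 * ln ((s - x) / (s - q))
    - 2 * ln ((f s - f x) / (f s - f q)))"
  have dG: "(G has_real_derivative koebe_defect f f' f'' x s / (s - x)) (at x)"
    if x: "x \<in> closed_segment q r" for x
  proof -
    note d = regular_derivs[OF sub(1)[OF x] ends_in_segment(1)]
    have ne: "s - x \<noteq> 0" "s - q \<noteq> 0" "f s - f x \<noteq> 0" "f s - f q \<noteq> 0" "f' x \<noteq> 0" "f' q \<noteq> 0"
      using sub(2-4)[OF x] by auto
    have "((\<lambda>x. ln (f' x / f' q)) has_real_derivative f'' x / f' x) (at x)"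
      using sub(3)[OF x] d(1,2) ne by (auto intro!: derivative_eq_intros)
    moreover have "((\<lambda>x. ln ((s - x) / (s - q))) has_real_derivative - 1 / (s - x)) (at x)"
      using sub(2)[OF x] ne by (auto intro!: derivative_eq_intros simp: divide_simps)
    moreover have "((\<lambda>x. ln ((f s - f x) / (f s - f q))) has_real_derivative - f' x / (f s - f x)) (at x)"
      using sub(4)[OF x] d(1,2) ne by (auto intro!: derivative_eq_intros simp: divide_simps)
    ultimately have "(G has_real_derivative
        f'' x / f' x + 2 * (- 1 / (s - x)) - 2 * (- f' x / (f s - f x))) (at x)"
      unfolding G_def by (intro DERIV_diff DERIV_add DERIV_cmult)
    moreover have "f'' x / f' x + 2 * (- 1 / (s - x)) - 2 * (- f' x / (f s - f x))
      = koebe_defect f f' f'' x s / (s - x)"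
    proof -
      have "koebe_defect f f' f'' x s = (s - x) * (f'' x / f' x + 2 * (f' x / (f s - f x))) - 2"
        unfolding koebe_defect_def by (simp add: distrib_left mult_ac)
      then show ?thesis using ne by (simp add: diff_divide_distrib)
    qed
    ultimately show ?thesis by simp
  qed
  have "q \<noteq> r" using r by (auto simp: open_segment_def)
  obtain z where z: "z \<in> open_segment q r"
    "G r - G q = (r - q) * (koebe_defect f f' f'' z s / (s - z))"
    by (rule mvt_segment[OF \<open>q \<noteq> r\<close> dG])
  have z': "z \<in> closed_segment q r" using z(1) by (simp add: open_segment_def)
  \<comment> \<open>In both orientations \<open>r - q\<close> and \<open>s - z\<close> have the same
    sign, so absolute values may be used; and \<open>z\<close> is no farther from \<open>s\<close>
    than \<open>q\<close> is, so \<open>\<sigma>\<close> can be evaluated at the larger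
    length.\<close>
  have "q < r \<and> r < s \<and> q < z \<and> z < r \<or> s < r \<and> r < q \<and> r < z \<and> z < q"
    using z(1) r by (auto simp: open_segment_eq_real_ivl split: if_splits)
  then have pos: "(r - q) / (s - z) > 0" and zs: "z \<noteq> s" and le: "\<bar>s - z\<bar> \<le> \<bar>s - q\<bar>"
    by (auto simp: zero_less_divide_iff)
  have sgn: "\<bar>r - q\<bar> / \<bar>s - z\<bar> = (r - q) / (s - z)"
    using abs_of_pos[OF pos] by (simp only: abs_divide)
  from le have \<sigma>z: "\<sigma> \<bar>s - z\<bar> \<le> \<sigma> \<bar>s - q\<bar>"
    using \<sigma>(1) by (simp add: gauge_function_def strict_mono_less_eq)
  have "G q = 0"
    using sub(2-4)[of q] by (auto simp: G_def split: if_splits)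
  have "- (\<bar>r - q\<bar> * \<sigma> \<bar>s - z\<bar>) = \<bar>r - q\<bar> / \<bar>s - z\<bar> * - (\<bar>s - z\<bar> * \<sigma> \<bar>s - z\<bar>)"
    using zs by simp
  also have "\<dots> \<le> \<bar>r - q\<bar> / \<bar>s - z\<bar> * koebe_defect f f' f'' z s"
    by (intro mult_left_mono \<sigma>(2) sub(1)[OF z']) auto
  also have "\<dots> = (r - q) * (koebe_defect f f' f'' z s / (s - z))"
    by (simp add: sgn)
  also have "\<dots> = G r" using z(2) \<open>G q = 0\<close> by simp
  finally have "G r \<ge> - (\<bar>r - q\<bar> * \<sigma> \<bar>s - z\<bar>)" .
  moreover have "\<bar>r - q\<bar> * \<sigma> \<bar>s - z\<bar> \<le> \<sigma> \<bar>s - q\<bar> * \<bar>r - q\<bar>"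
    using \<sigma>z by (metis abs_ge_zero mult.commute mult_left_mono)
  ultimately have "exp (- (\<sigma> \<bar>s - q\<bar> * \<bar>r - q\<bar>)) \<le> exp (G r)" by simp
  also have "exp (G r) = koebe_ratio f f' q r s"
  proof -
    note p = sub(2-4)[OF ends_in_segment(2)]
    have e2: "exp (2 * ln y) = y\<^sup>2" if "y > 0" for y :: real
      using that by (simp only: mult_2 exp_add exp_ln power2_eq_square)
    show ?thesis
      unfolding G_def exp_diff exp_add exp_ln[OF p(2)] e2[OF p(1)] e2[OF p(3)]
      by (simp add: koebe_ratio_def power_divide) (simp add: mult_ac)
  qed
  finally show ?thesis .
qed

end

section \<open>Betweenness, length and distance to the frontier\<close>

lemma continuous_inj_segment:
  fixes F :: "real \<Rightarrow> real"
  assumes cont: "continuous_on (closed_segment q s) F" and inj: "inj_on F (closed_segment q s)"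
    and r: "r \<in> open_segment q s"
  shows "F r \<in> open_segment (F q) (F s)"
proof (cases "q < s")
  case True
  with r cont inj show ?thesis
    using continuous_inj_imp_mono[of q r s F]
    by (auto simp: open_segment_eq_real_ivl closed_segment_eq_real_ivl split: if_splits)
next
  case False
  then have "s < r" "r < q" using r by (auto simp: open_segment_eq_real_ivl split: if_splits)
  with r cont inj show ?thesis
    using continuous_inj_imp_mono[of s r q F]
    by (auto simp: open_segment_eq_real_ivl closed_segment_eq_real_ivl split: if_splits)
qed

text \<open>Boundedness matters: \<open>len\<close> has the default value 0 on sets of infinite
  measure.\<close>

lemma abs_diff_le_len:
  fixes A :: "real set"
  assumes "is_interval A" "bounded A" "x \<in> A" "y \<in> A"
  shows "\<bar>x - y\<bar> \<le> len A"
proof -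
  have "closed_segment x y \<subseteq> A"
    using assms by (simp add: closed_segment_subset is_interval_convex)
  moreover have "A \<in> sets lborel" "emeasure lborel A \<noteq> \<infinity>"
    using assms(1,2) emeasure_bounded_finite[of A]
      real_interval_borel_measurable[of A] by auto
  ultimately have "measure lborel (closed_segment x y) \<le> measure lborel A"
    by (intro measure_mono_fmeasurable) (auto simp: fmeasurable_def less_top)
  then show ?thesis by (auto simp: closed_segment_eq_real_ivl split: if_splits)
qed

text \<open>Otherwise \<open>y\<close> or \<open>s\<close> would be the middle point, and by
  \<open>continuous_inj_segment\<close> its image would be the middle one. This carries the position
  of a point chosen in the image back to \<open>T\<close>.\<close>

lemma inj_segment_reflect:
  fixes F :: "real \<Rightarrow> real"
  assumes cont: "continuous_on T F" and inj: "inj_on F T" and T: "is_interval T"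
    and mem: "x \<in> T" "y \<in> T" "s \<in> T" and Fx: "F x \<in> open_segment (F y) (F s)"
  shows "x \<in> open_segment y s"
proof (rule ccontr)
  assume "x \<notin> open_segment y s"
  moreover have "x \<noteq> y" "x \<noteq> s" using Fx by (auto simp: open_segment_def)
  moreover have "y \<noteq> s" using Fx by auto
  ultimately have "y \<in> open_segment x s \<or> s \<in> open_segment y x"
    by (auto simp: open_segment_eq_real_ivl split: if_splits)
  moreover have "F v \<in> open_segment (F u) (F w)"
    if "v \<in> open_segment u w" "u \<in> T" "w \<in> T" for u v w
  proof -
    have "closed_segment u w \<subseteq> T"
      using that T by (simp add: closed_segment_subset is_interval_convex)
    then show ?thesis
      using continuous_inj_segment[OF _ _ that(1)] cont inj
      by (meson continuous_on_subset inj_on_subset)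
  qed
  ultimately have "F y \<in> open_segment (F x) (F s) \<or> F s \<in> open_segment (F y) (F x)"
    using mem by blast
  with Fx show False by (auto simp: open_segment_eq_real_ivl split: if_splits)
qed

text \<open>The ball is connected, so on leaving \<open>A\<close> it would meet the frontier at a
  distance from \<open>z\<close> below the infimum.\<close>

lemma ball_setdist_frontier_subset:
  fixes z :: "'a::real_normed_vector"
  assumes "z \<in> J" "J \<subseteq> A"
  shows "ball z (setdist J (frontier A)) \<subseteq> A"
proof (rule ccontr)
  assume not_sub: "\<not> ball z (setdist J (frontier A)) \<subseteq> A"
  then have "setdist J (frontier A) > 0"
    by (metis ball_empty empty_subsetI not_le_imp_less)
  then have "z \<in> ball z (setdist J (frontier A)) \<inter> A"
    using assms by auto
  then have "ball z (setdist J (frontier A)) \<inter> A \<noteq> {}" by blast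
  moreover have "ball z (setdist J (frontier A)) - A \<noteq> {}" using not_sub by blast
  ultimately have "ball z (setdist J (frontier A)) \<inter> frontier A \<noteq> {}"
    by (rule connected_Int_frontier[OF connected_ball])
  then obtain w where "w \<in> ball z (setdist J (frontier A))" "w \<in> frontier A" by auto
  then show False using setdist_le_dist[OF assms(1), of w "frontier A"] by auto
qed

text \<open>The domain factor of the outer map is the reciprocal of the image factor of the inner
  map, so the two cancel.\<close>

lemma koebe_ratio_comp:
  assumes "g s \<noteq> g q" "g s \<noteq> g r"
  shows "koebe_ratio (F \<circ> g) (\<lambda>x. F' (g x) * g' x) q r s
    = koebe_ratio F F' (g q) (g r) (g s) * koebe_ratio g g' q r s"
proof -
  have "((g s - g r) / (g s - g q))\<^sup>2 * ((g s - g q) / (g s - g r))\<^sup>2 = 1"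
    using assms by (simp flip: power_mult_distrib)
  then show ?thesis by (simp add: koebe_ratio_def)
qed

section \<open>Iterates and their chain rule derivative\<close>

context nonflat_interval_map
begin

lemma iterate_maps: "x \<in> {a..b} \<Longrightarrow> (f ^^ i) x \<in> {a..b}"
  using maps by (induction i) auto

lemma continuous_iterate: "continuous_on {a..b} (f ^^ i)"
proof (induction i)
  case (Suc i)
  have "continuous_on ((f ^^ i) ` {a..b}) f"
    using iterate_maps by (intro continuous_on_subset[OF continuous_f]) blast
  then show ?case using continuous_on_compose[OF Suc] by simp
qed (simp add: id_def)

definition iterate_deriv :: "nat \<Rightarrow> real \<Rightarrow> real" where
  "iterate_deriv n x = (\<Prod>i<n. f' ((f ^^ i) x))"

lemma koebe_ratio_iterate:
  assumes \<sigma>: "gauge_function \<sigma>"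
    "\<And>t s. regular t s \<Longrightarrow> koebe_defect f f' f'' t s \<ge> - (\<bar>s - t\<bar> * \<sigma> \<bar>s - t\<bar>)"
    and "r \<in> open_segment q s"
    and "\<And>i. i < n \<Longrightarrow> regular ((f ^^ i) q) ((f ^^ i) s)"
    and "\<And>i. i < n \<Longrightarrow> (f ^^ i) r \<in> open_segment ((f ^^ i) q) ((f ^^ i) s)"
  shows "koebe_ratio (f ^^ n) (iterate_deriv n) q r s
    \<ge> exp (- (\<Sum>i<n. \<sigma> \<bar>(f ^^ i) s - (f ^^ i) q\<bar> * \<bar>(f ^^ i) r - (f ^^ i) q\<bar>))"
  using assms(4,5)
proof (induction n)
  case 0
  have "s \<noteq> r" "s \<noteq> q" using assms(3) by (auto simp: open_segment_def)
  then have "koebe_ratio id (\<lambda>x. 1) q r s = 1"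
    by (simp add: koebe_ratio_def flip: power_mult_distrib)
  then show ?case by (simp add: iterate_deriv_def[abs_def] id_def)
next
  case (Suc n)
  define Q R S where "Q = (f ^^ n) q" and "R = (f ^^ n) r" and "S = (f ^^ n) s"
  have reg: "regular Q S" and R: "R \<in> open_segment Q S"
    using Suc.prems[of n] by (simp_all add: Q_def R_def S_def)
  have IH: "koebe_ratio (f ^^ n) (iterate_deriv n) q r s
    \<ge> exp (- (\<Sum>i<n. \<sigma> \<bar>(f ^^ i) s - (f ^^ i) q\<bar> * \<bar>(f ^^ i) r - (f ^^ i) q\<bar>))"
    using Suc by simp
  have step: "koebe_ratio f f' Q R S \<ge> exp (- (\<sigma> \<bar>S - Q\<bar> * \<bar>R - Q\<bar>))"
    by (rule koebe_ratio_step[OF \<sigma> reg R])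
  have "S \<noteq> Q" "S \<noteq> R" using R by (auto simp: open_segment_def)
  then have "koebe_ratio (f \<circ> f ^^ n) (\<lambda>x. f' ((f ^^ n) x) * iterate_deriv n x) q r s
      = koebe_ratio f f' Q R S * koebe_ratio (f ^^ n) (iterate_deriv n) q r s"
    unfolding Q_def R_def S_def by (rule koebe_ratio_comp)
  moreover have "(\<lambda>x. f' ((f ^^ n) x) * iterate_deriv n x) = iterate_deriv (Suc n)"
    by (simp add: fun_eq_iff iterate_deriv_def mult.commute)
  moreover have "exp (- (\<sigma> \<bar>S - Q\<bar> * \<bar>R - Q\<bar>))
      * exp (- (\<Sum>i<n. \<sigma> \<bar>(f ^^ i) s - (f ^^ i) q\<bar> * \<bar>(f ^^ i) r - (f ^^ i) q\<bar>))
      \<le> koebe_ratio f f' Q R S * koebe_ratio (f ^^ n) (iterate_deriv n) q r s"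
    using order.trans[OF exp_ge_zero step] by (intro mult_mono step IH) auto
  ultimately show ?case
    unfolding funpow.simps sum.lessThan_Suc minus_add_distrib exp_add
    by (simp only: Q_def R_def S_def mult.commute)
qed

section \<open>Iterates that are diffeomorphisms on an open interval\<close>

context
  fixes T :: "real set" and n :: nat
  assumes T: "open T" "is_interval T" "T \<subseteq> {a..b}" and diffeo: "C_diffeo_on 1 (f ^^ n) T"
begin

text \<open>A collision under an earlier iterate would persist through the remaining
  \<open>n - i\<close> steps.\<close>

lemma iterate_inj:
  assumes "i \<le> n"
  shows "inj_on (f ^^ i) T"
proof -
  have "f ^^ n = (f ^^ (n - i)) \<circ> (f ^^ i)" using assms by (simp flip: funpow_add)
  then show ?thesis
    using diffeo by (metis C_diffeo_on_def inj_on_imageI2)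
qed

lemma continuous_iterate_on: "continuous_on T (f ^^ i)"
  using continuous_iterate T(3) by (rule continuous_on_subset)

lemma iterate_image_subset: "(f ^^ i) ` T \<subseteq> {a..b}"
  using iterate_maps T(3) by blast

text \<open>Continuous injective images of open subsets of the line are open, and an open subset of
  \<open>{a..b}\<close> misses the endpoints, where the derivatives are only one-sided.\<close>

lemma iterate_image_interior:
  assumes "i \<le> n"
  shows "(f ^^ i) ` T \<subseteq> {a<..<b}"
proof -
  have "open ((f ^^ i) ` T)"
    using injective_into_1d_imp_open_map_UNIV[OF T(1) continuous_iterate_on[of i] iterate_inj[OF assms]]
    by simp
  then show ?thesis
    using iterate_image_subset interior_maximal by (metis interior_atLeastAtMost_real)
qed

lemma iterate_has_deriv:
  assumes "i \<le> n" "x \<in> T"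
  shows "(f ^^ i has_real_derivative iterate_deriv i x) (at x)"
  using assms(1)
proof (induction i)
  case 0
  then show ?case by (simp add: iterate_deriv_def id_def)
next
  case (Suc i)
  have "(f ^^ i) x \<in> {a<..<b}" using iterate_image_interior[of i] Suc.prems assms(2) by auto
  then have "(f \<circ> (f ^^ i) has_real_derivative f' ((f ^^ i) x) * iterate_deriv i x) (at x)"
    using Suc by (intro DERIV_chain deriv_interior) auto
  then show ?case by (simp add: iterate_deriv_def mult.commute comp_def)
qed

text \<open>A diffeomorphism of an open set has nonvanishing derivative. As that derivative is a
  product along the orbit, no image of \<open>T\<close> before time \<open>n\<close> meets a
  critical point.\<close>

lemma iterate_deriv_nonzero:
  assumes "x \<in> T"
  shows "iterate_deriv n x \<noteq> 0" and "i < n \<Longrightarrow> f' ((f ^^ i) x) \<noteq> 0"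
proof -
  show "iterate_deriv n x \<noteq> 0"
    using C_diffeo_on_deriv_nonzero[of 0 "f ^^ n" T x] iterate_has_deriv[of n x] diffeo T(1) assms
    by simp
  then show "i < n \<Longrightarrow> f' ((f ^^ i) x) \<noteq> 0" by (auto simp: iterate_deriv_def)
qed

text \<open>Each factor is positive, because \<open>f'\<close> is continuous without zeros on the
  connected image of \<open>T\<close> under the corresponding iterate.\<close>

lemma iterate_deriv_ratio_pos:
  assumes "x \<in> T" "y \<in> T"
  shows "iterate_deriv n x / iterate_deriv n y > 0"
proof -
  have "f' ((f ^^ i) x) / f' ((f ^^ i) y) > 0" if "i < n" for i
  proof -
    have "connected ((f ^^ i) ` T)"
      using T(2) continuous_iterate_on by (simp add: connected_continuous_image is_interval_connected)
    moreover have "continuous_on ((f ^^ i) ` T) f'"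
      using iterate_image_subset by (rule continuous_on_subset[OF continuous_deriv])
    ultimately have "f' ((f ^^ i) x) * f' ((f ^^ i) y) > 0"
      by (rule connected_nonzero_same_sign) (use assms iterate_deriv_nonzero(2) that in auto)
    then show ?thesis by (auto simp: zero_less_divide_iff zero_less_mult_iff)
  qed
  then show ?thesis
    unfolding iterate_deriv_def prod_dividef[symmetric] by (intro prod_pos) auto
qed

lemma iterate_regular:
  assumes "i < n" "q \<in> T" "s \<in> T" "q \<noteq> s"
  shows "regular ((f ^^ i) q) ((f ^^ i) s)"
proof -
  have "convex ((f ^^ i) ` T)"
    using T(2) continuous_iterate_on
    by (simp add: connected_continuous_image is_interval_connected flip: connected_convex_1)
  then have "closed_segment ((f ^^ i) q) ((f ^^ i) s) \<subseteq> (f ^^ i) ` T"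
    using assms by (intro closed_segment_subset) auto
  moreover have "(f ^^ i) q \<noteq> (f ^^ i) s"
    using iterate_inj[of i] assms by (auto dest: inj_onD)
  ultimately show ?thesis
    using iterate_image_interior[of i] iterate_deriv_nonzero(2) assms(1) by (auto simp: regular_def)
qed

lemma iterate_is_interval: "is_interval J \<Longrightarrow> J \<subseteq> T \<Longrightarrow> is_interval ((f ^^ i) ` J)"
  using continuous_on_subset[OF continuous_iterate_on]
  by (simp add: is_interval_connected_1 connected_continuous_image)

lemma iterate_abs_diff_le_len:
  assumes "is_interval J" "J \<subseteq> T" "u \<in> J" "v \<in> J"
  shows "\<bar>(f ^^ i) u - (f ^^ i) v\<bar> \<le> len ((f ^^ i) ` J)"
proof (rule abs_diff_le_len)
  have "(f ^^ i) ` J \<subseteq> {a..b}" using assms(2) iterate_image_subset by blast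
  then show "bounded ((f ^^ i) ` J)" using bounded_closed_interval bounded_subset by blast
qed (use assms iterate_is_interval in auto)

text \<open>For \<open>n = 0\<close> the maximum ranges over the empty set and has no meaningful
  value, but the empty sum makes the product 0.\<close>

definition total_distortion :: "(real \<Rightarrow> real) \<Rightarrow> real set \<Rightarrow> real" where
  "total_distortion \<sigma> J = \<sigma> (MAX i\<in>{..<n}. len ((f ^^ i) ` T)) * (\<Sum>i<n. len ((f ^^ i) ` J))"

text \<open>Distances along the orbit are at most the lengths of image intervals: those of
  \<open>T\<close> inside the monotone \<open>\<sigma>\<close>, those of \<open>J\<close> as the
  other factor.\<close>

lemma total_distortion_bound:
  assumes \<sigma>: "gauge_function \<sigma>" and J: "is_interval J" "J \<subseteq> T" "x \<in> J" "y \<in> J" and "s \<in> T"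
  shows "0 \<le> total_distortion \<sigma> J"
    and "(\<Sum>i<n. \<sigma> \<bar>(f ^^ i) s - (f ^^ i) y\<bar> * \<bar>(f ^^ i) x - (f ^^ i) y\<bar>) \<le> total_distortion \<sigma> J"
proof -
  have mono: "\<sigma> u \<le> \<sigma> v" if "u \<le> v" for u v
    using \<sigma> that by (simp add: gauge_function_def strict_mono_less_eq)
  have nonneg: "0 \<le> \<sigma> u" if "0 \<le> u" for u
    using \<sigma> mono[OF that] by (simp add: gauge_function_def)
  define M where "M = (MAX i\<in>{..<n}. len ((f ^^ i) ` T))"
  have M: "len ((f ^^ i) ` T) \<le> M" if "i < n" for i
    unfolding M_def using that by (intro Max_ge) auto
  have summand: "0 \<le> \<sigma> M * len ((f ^^ i) ` J)"
    "\<sigma> \<bar>(f ^^ i) s - (f ^^ i) y\<bar> * \<bar>(f ^^ i) x - (f ^^ i) y\<bar> \<le> \<sigma> M * len ((f ^^ i) ` J)"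
    if "i < n" for i
  proof -
    have "0 \<le> \<sigma> M" using M[OF that] by (intro nonneg) (meson measure_nonneg order_trans)
    moreover have "\<bar>(f ^^ i) s - (f ^^ i) y\<bar> \<le> M"
      using iterate_abs_diff_le_len[OF T(2) order.refl, of s y i] M[OF that] J assms(6) by auto
    ultimately show "0 \<le> \<sigma> M * len ((f ^^ i) ` J)"
      "\<sigma> \<bar>(f ^^ i) s - (f ^^ i) y\<bar> * \<bar>(f ^^ i) x - (f ^^ i) y\<bar> \<le> \<sigma> M * len ((f ^^ i) ` J)"
      using iterate_abs_diff_le_len[OF J] by (auto intro!: mult_mono mono)
  qed
  show "0 \<le> total_distortion \<sigma> J"
    unfolding total_distortion_def sum_distrib_left M_def[symmetric]
    by (intro sum_nonneg summand(1)) simp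
  show "(\<Sum>i<n. \<sigma> \<bar>(f ^^ i) s - (f ^^ i) y\<bar> * \<bar>(f ^^ i) x - (f ^^ i) y\<bar>) \<le> total_distortion \<sigma> J"
    unfolding total_distortion_def sum_distrib_left M_def[symmetric]
    by (intro sum_mono summand(2)) simp
qed

section \<open>Koebe distortion for iterates\<close>

text \<open>The domain factor of the ratio is at most 1 because \<open>x\<close> lies between
  \<open>y\<close> and \<open>s\<close>, so only the derivatives and the image factor
  remain.\<close>

lemma three_point_distortion:
  assumes \<sigma>: "gauge_function \<sigma>"
    "\<And>t s. regular t s \<Longrightarrow> koebe_defect f f' f'' t s \<ge> - (\<bar>s - t\<bar> * \<sigma> \<bar>s - t\<bar>)"
    and J: "is_interval J" "J \<subseteq> T" "x \<in> J" "y \<in> J" and "s \<in> T" and x: "x \<in> open_segment y s"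
  shows "exp (- total_distortion \<sigma> J) \<le> iterate_deriv n x / iterate_deriv n y
    * (((f ^^ n) s - (f ^^ n) y) / ((f ^^ n) s - (f ^^ n) x))\<^sup>2"
proof -
  have mem: "x \<in> T" "y \<in> T" using J by auto
  have "y \<noteq> s" using x by auto
  have sub: "closed_segment y s \<subseteq> T"
    using mem \<open>s \<in> T\<close> T(2) by (simp add: closed_segment_subset is_interval_convex)
  have mid: "(f ^^ i) x \<in> open_segment ((f ^^ i) y) ((f ^^ i) s)" if "i < n" for i
    using that
    by (intro continuous_inj_segment[OF continuous_on_subset[OF continuous_iterate_on sub]
          inj_on_subset[OF iterate_inj sub] x]) simp
  define R where "R = iterate_deriv n x / iterate_deriv n y
    * (((f ^^ n) s - (f ^^ n) y) / ((f ^^ n) s - (f ^^ n) x))\<^sup>2"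
  have "R \<ge> 0"
    unfolding R_def
    by (rule mult_nonneg_nonneg[OF less_imp_le[OF iterate_deriv_ratio_pos[OF mem]] zero_le_power2])
  have "exp (- total_distortion \<sigma> J)
    \<le> exp (- (\<Sum>i<n. \<sigma> \<bar>(f ^^ i) s - (f ^^ i) y\<bar> * \<bar>(f ^^ i) x - (f ^^ i) y\<bar>))"
    using total_distortion_bound(2)[OF \<sigma>(1) J \<open>s \<in> T\<close>] by simp
  also have "\<dots> \<le> koebe_ratio (f ^^ n) (iterate_deriv n) y x s"
    by (rule koebe_ratio_iterate[OF \<sigma> x iterate_regular[OF _ mem(2) \<open>s \<in> T\<close> \<open>y \<noteq> s\<close>] mid])
  also have "\<dots> = R * ((s - x) / (s - y))\<^sup>2" by (simp add: koebe_ratio_def R_def)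
  also have "\<dots> \<le> R * 1"
  proof (rule mult_left_mono[OF _ \<open>R \<ge> 0\<close>])
    have "\<bar>(s - x) / (s - y)\<bar> \<le> 1"
      using x by (auto simp: open_segment_eq_real_ivl divide_le_eq split: if_splits)
    then show "((s - x) / (s - y))\<^sup>2 \<le> 1" by (simp add: abs_square_le_1)
  qed
  finally show ?thesis by (simp add: R_def)
qed

text \<open>The third point is chosen in the image, beyond \<open>F x\<close> as seen from
  \<open>F y\<close> and at distance \<open>\<delta> < d\<close> from \<open>F x\<close>. The image
  factor is then exactly \<open>(1 + L / \<delta>)\<^sup>2\<close>, and \<open>\<delta>\<close>
  tends to \<open>d\<close>.\<close>

lemma koebe_distortion:
  assumes \<sigma>: "gauge_function \<sigma>"
    "\<And>t s. regular t s \<Longrightarrow> koebe_defect f f' f'' t s \<ge> - (\<bar>s - t\<bar> * \<sigma> \<bar>s - t\<bar>)"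
    and J: "is_interval J" "J \<subseteq> T" "x \<in> J" "y \<in> J"
    and d: "d = setdist ((f ^^ n) ` J) (frontier ((f ^^ n) ` T))" "d > 0"
  shows "exp (- total_distortion \<sigma> J) / (1 + len ((f ^^ n) ` J) / d)\<^sup>2
    \<le> iterate_deriv n x / iterate_deriv n y"
proof -
  define F where "F = f ^^ n"
  define E where "E = exp (- total_distortion \<sigma> J)"
  define R where "R = iterate_deriv n x / iterate_deriv n y"
  define L where "L = \<bar>F x - F y\<bar>"
  have mem: "x \<in> T" "y \<in> T" using J by auto
  have R: "R > 0" unfolding R_def by (rule iterate_deriv_ratio_pos[OF mem])
  have L: "0 \<le> L" "L \<le> len (F ` J)"
    unfolding L_def F_def using iterate_abs_diff_le_len[OF J] by auto
  have "E \<le> R * (1 + L / d)\<^sup>2"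
  proof (cases "x = y")
    case True
    then show ?thesis
      using total_distortion_bound(1)[OF \<sigma>(1) J mem(1)] iterate_deriv_nonzero(1)[OF mem(1)]
      by (simp add: E_def R_def L_def)
  next
    case False
    have Fne: "F x \<noteq> F y"
      using iterate_inj[of n] False mem by (auto simp: F_def dest: inj_onD)
    have *: "E \<le> R * (1 + L / \<delta>)\<^sup>2" if \<delta>: "0 < \<delta>" "\<delta> < d" for \<delta>
    proof -
      define v where "v = F x + \<delta> * sgn (F x - F y)"
      have "dist (F x) v < d" using \<delta> Fne by (simp add: v_def dist_real_def abs_mult abs_sgn_eq)
      then have "v \<in> F ` T"
        using ball_setdist_frontier_subset[OF imageI[OF J(3)] image_mono[OF J(2)], of F] d(1)
        by (auto simp: F_def)
      then obtain s where s: "s \<in> T" "v = F s" by auto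
      have "F x \<in> open_segment (F y) (F s)"
        unfolding s(2)[symmetric] v_def using \<delta>(1) Fne
        by (auto simp: open_segment_eq_real_ivl sgn_if)
      then have "x \<in> open_segment y s"
        using inj_segment_reflect[OF continuous_iterate_on iterate_inj[OF order.refl] T(2) mem s(1)]
        by (simp add: F_def)
      from three_point_distortion[OF \<sigma> J s(1) this]
      have "E \<le> R * ((F s - F y) / (F s - F x))\<^sup>2" by (simp add: E_def R_def F_def)
      also have "(F s - F y) / (F s - F x) = 1 + L / \<delta>"
        unfolding s(2)[symmetric] v_def L_def using \<delta>(1) Fne
        by (cases "F x > F y") (simp_all add: sgn_if field_simps)
      finally show ?thesis .
    qed
    \<comment> \<open>The limit is needed because a point at distance exactly \<open>d\<close> may
      be an endpoint of the open image.\<close>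
    have "((\<lambda>\<delta>. R * (1 + L / \<delta>)\<^sup>2) \<longlongrightarrow> R * (1 + L / d)\<^sup>2) (at_left d)"
      using d(2) by (intro tendsto_intros) auto
    moreover have "\<forall>\<^sub>F \<delta> in at_left d. E \<le> R * (1 + L / \<delta>)\<^sup>2"
      using * d(2) unfolding eventually_at_left_field by (intro exI[of _ 0]) auto
    ultimately show ?thesis by (rule tendsto_lowerbound) simp
  qed
  also have "\<dots> \<le> R * (1 + len (F ` J) / d)\<^sup>2"
    using R L d(2) by (intro mult_left_mono power_mono add_left_mono divide_right_mono) auto
  finally have "E \<le> R * (1 + len (F ` J) / d)\<^sup>2" .
  moreover have "(1 + len (F ` J) / d)\<^sup>2 > 0"
    using d(2) by (intro zero_less_power add_pos_nonneg divide_nonneg_pos) auto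
  ultimately show ?thesis by (simp add: E_def R_def F_def pos_divide_le_eq)
qed

lemma koebe_distortion_nu:
  assumes \<sigma>: "gauge_function \<sigma>"
    "\<And>t s. regular t s \<Longrightarrow> koebe_defect f f' f'' t s \<ge> - (\<bar>s - t\<bar> * \<sigma> \<bar>s - t\<bar>)"
    and J: "is_interval J" "J \<subseteq> T" "x \<in> J" "y \<in> J"
  shows "ereal (exp (- total_distortion \<sigma> J)) / (1 + nu ((f ^^ n) ` J) ((f ^^ n) ` T))\<^sup>2
    \<le> ereal (deriv (f ^^ n) x / deriv (f ^^ n) y)"
proof -
  define d where "d = setdist ((f ^^ n) ` J) (frontier ((f ^^ n) ` T))"
  have mem: "x \<in> T" "y \<in> T" using J by auto
  have D: "deriv (f ^^ n) x / deriv (f ^^ n) y = iterate_deriv n x / iterate_deriv n y"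
    using mem by (simp only: DERIV_imp_deriv[OF iterate_has_deriv[OF order.refl]])
  show ?thesis
  proof (cases "d = 0")
    \<comment> \<open>Here \<open>nu\<close> is infinite and the lower bound is 0, so positivity of
      the derivative ratio suffices.\<close>
    case True
    then have "ereal (exp (- total_distortion \<sigma> J)) / (1 + nu ((f ^^ n) ` J) ((f ^^ n) ` T))\<^sup>2 = 0"
      by (simp add: nu_def d_def power2_eq_square)
    with iterate_deriv_ratio_pos[OF mem] show ?thesis by (simp only: D) (simp add: less_imp_le)
  next
    case False
    then have "d > 0"
      using setdist_pos_le[of "(f ^^ n) ` J" "frontier ((f ^^ n) ` T)"] unfolding d_def by linarith
    have "1 + len ((f ^^ n) ` J) / d > 0"
      using \<open>d > 0\<close> by (intro add_pos_nonneg divide_nonneg_pos) auto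
    then have "ereal (exp (- total_distortion \<sigma> J)) / (1 + nu ((f ^^ n) ` J) ((f ^^ n) ` T))\<^sup>2
      = ereal (exp (- total_distortion \<sigma> J) / (1 + len ((f ^^ n) ` J) / d)\<^sup>2)"
      using False by (simp add: nu_def d_def one_ereal_def power2_eq_square)
    also have "\<dots> \<le> ereal (iterate_deriv n x / iterate_deriv n y)"
      using koebe_distortion[OF \<sigma> J d_def \<open>d > 0\<close>] by simp
    finally show ?thesis by (simp add: D)
  qed
qed

end

end

theorem proposition1:
  fixes f :: "real \<Rightarrow> real" and a b :: real
  assumes "a < b"
    and "f ` {a..b} \<subseteq> {a..b}"
    and "C_on 2 f {a..b}"
    and "\<And>c. critical_point f {a..b} c \<Longrightarrow> nonflat 2 f {a..b} c"
  shows "\<exists>\<sigma>. gauge_function \<sigma> \<and>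
    (\<forall>J T. \<forall>n::nat.
      open J \<and> is_interval J \<and> open T \<and> is_interval T \<and> J \<subseteq> T \<and> T \<subseteq> {a..b} \<and>
      C_diffeo_on 1 (f ^^ n) T \<longrightarrow>
      (\<forall>x\<in>J. \<forall>y\<in>J.
        ereal (deriv (f ^^ n) x / deriv (f ^^ n) y) \<ge>
          ereal (exp (- (\<sigma> (MAX i\<in>{..<n}. len ((f ^^ i) ` T)) *
                          (\<Sum>i<n. len ((f ^^ i) ` J))))) /
          (1 + nu ((f ^^ n) ` J) ((f ^^ n) ` T))\<^sup>2))"
proof -
  obtain f' f'' where
    d: "\<forall>x\<in>{a..b}. (f has_real_derivative f' x) (at x within {a..b})"
      "\<forall>x\<in>{a..b}. (f' has_real_derivative f'' x) (at x within {a..b})"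
      "continuous_on {a..b} f''"
    using assms(3) unfolding numeral_2_eq_2 C_on.simps by blast
  interpret nonflat_interval_map f f' f'' a b
  proof
    show "f x \<in> {a..b}" if "x \<in> {a..b}" for x using assms(2) that by blast
    fix c assume c: "c \<in> {a..b}" "f' c = 0"
    then have "critical_point f {a..b} c"
      using bspec[OF d(1) c(1)] by (simp add: critical_point_def)
    then show "nonflat 2 f {a..b} c" by (rule assms(4))
  qed (use d in auto)
  \<comment> \<open>The gauge is obtained before \<open>J\<close>, \<open>T\<close> and
    \<open>n\<close> enter, so it depends only on the map and its interval.\<close>
  obtain \<sigma> where \<sigma>: "gauge_function \<sigma>"
    "\<And>t s. regular t s \<Longrightarrow> koebe_defect f f' f'' t s \<ge> - (\<bar>s - t\<bar> * \<sigma> \<bar>s - t\<bar>)"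
    using koebe_defect_gauge by blast
  show ?thesis
  proof (intro exI[of _ \<sigma>] conjI \<sigma>(1) allI impI ballI)
    fix J T and n :: nat and x y
    assume A: "open J \<and> is_interval J \<and> open T \<and> is_interval T \<and> J \<subseteq> T \<and> T \<subseteq> {a..b} \<and>
      C_diffeo_on 1 (f ^^ n) T" and xy: "x \<in> J" "y \<in> J"
    then have T: "open T" "is_interval T" "T \<subseteq> {a..b}" "C_diffeo_on 1 (f ^^ n) T"
      and J: "is_interval J" "J \<subseteq> T" by auto
    show "ereal (deriv (f ^^ n) x / deriv (f ^^ n) y) \<ge>
          ereal (exp (- (\<sigma> (MAX i\<in>{..<n}. len ((f ^^ i) ` T)) *
                          (\<Sum>i<n. len ((f ^^ i) ` J))))) /
          (1 + nu ((f ^^ n) ` J) ((f ^^ n) ` T))\<^sup>2"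
      using koebe_distortion_nu[OF T \<sigma> J xy] unfolding total_distortion_def[OF T] .
  qed
qed

end
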